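(* Let $d\ge 3$ and let $C\in\mathcal{C}^d_{ar}$ have (normalized, $d$-monotone) generator $\psi$ with pseudo-inverse $\varphi$. For $\mathbf{x}=(x_1,\dots,x_{d-1})\in\mathbb{I}^{d-1}$ and $y\in\mathbb{I}$ set $$K_C(\mathbf{x},[0,y]):=\begin{cases}1, & M(\mathbf{x})=1 \text{ or } \mathbf{x}\in L_0^{1:d-1},\\ 0, & M(\mathbf{x})<1,\ \mathbf{x}\notin L_0^{1:d-1},\ y<f^0(\mathbf{x}),\\ \dfrac{D^-\psi^{(d-2)}\big(\sum_{i=1}^{d-1}\varphi(x_i)+\varphi(y)\big)}{D^-\psi^{(d-2)}\big(\sum_{i=1}^{d-1}\varphi(x_i)\big)}, & M(\mathbf{x})<1,\ \mathbf{x}\notin L_0^{1:d-1},\ y\ge f^0(\mathbf{x}).\end{cases}$$ Then for every $\mathbf{x}$, $y\mapsto K_C(\mathbf{x},[0,y])$ is a distribution function on $\mathbb{I}$, and the induced mapping $K_C:\mathbb{I}^{d-1}\times\mathcal{B}(\mathbb{I})\to\mathbb{I}$ is (a version of) the $(d-1)$-Markov kernel of $C$, i.e. a regular conditional distribution of $Y$ given $\mathbf{X}$ when $(\mathbf{X},Y)$ has distribution function $C$.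
   Context: $\mathbb{I}=[0,1]$. An Archimedean generator is a continuous non-increasing $\psi:[0,\infty)\to\mathbb{I}$ with $\psi(0)=1$, $\lim_{z\to\infty}\psi(z)=0=:\psi(\infty)$, strictly decreasing on $[0,\inf\{z\in[0,\infty]:\psi(z)=0\}]$; its pseudo-inverse is $\varphi(y)=\inf\{z\in[0,\infty]:\psi(z)=y\}$, $y\in\mathbb{I}$. $\psi$ is $d$-monotone if $(-1)^{d-2}\psi^{(d-2)}$ exists on $(0,\infty)$ and is non-negative, non-increasing and convex there. $\mathcal{C}^d_{ar}$ is the class of $d$-dimensional copulas of the form $C(\mathbf{u})=\psi(\varphi(u_1)+\dots+\varphi(u_d))$ with a $d$-monotone generator $\psi$, normalized so that $\psi(1)=1/2$. $D^-$ denotes the left-hand derivative; conventions: $D^-\psi^{(d-2)}(\infty)=0$, $\psi(\infty)=0$, $\psi(u)=1$ for $u<0$. $M(\mathbf{x})=\min_i x_i$. $L_0^{1:d-1}=\{\mathbf{x}\in\mathbb{I}^{d-1}:\sum_{i=1}^{d-1}\varphi(x_i)\ge\varphi(0)\}$, and $f^0(\mathbf{x})=1$ if $\mathbf{x}\in L_0^{1:d-1}$, $f^0(\mathbf{x})=\psi(\varphi(0)-\sum_{i=1}^{d-1}\varphi(x_i))$ otherwise. The $(d-1)$-Markov kernel of a $d$-copula $C$ is a Markov kernel $K$ from $\mathbb{I}^{d-1}$ to $\mathcal{B}(\mathbb{I})$ with $K(\mathbf{X},E)=\mathbb{E}(\mathbf{1}_E(Y)\mid\mathbf{X})$ a.s.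 for all Borel $E$, where $(\mathbf{X},Y)\sim C$; equivalently $\mu_C(G)=\int K(\mathbf{x},G_\mathbf{x})\,d\mu_{C^{1:d-1}}(\mathbf{x})$, with $C^{1:d-1}(\mathbf{x})=C(\mathbf{x},1)$. *)

theory Defs
  imports "HOL-Probability.Probability"
begin

text \<open>Generators are real functions; only their values on [0,\<infinity>) matter.
  psiE extends psi to extended reals with the conventions psi(\<infinity>) = 0 and psi(u) = 1 for u < 0.\<close>
definition psiE :: "(real \<Rightarrow> real) \<Rightarrow> ereal \<Rightarrow> real" where
  "psiE \<psi> z = (case z of ereal r \<Rightarrow> (if r < 0 then 1 else \<psi> r) | PInfty \<Rightarrow> 0 | MInfty \<Rightarrow> 1)"

definition phi :: "(real \<Rightarrow> real) \<Rightarrow> real \<Rightarrow> ereal" where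
  "phi \<psi> y = Inf {z::ereal. 0 \<le> z \<and> psiE \<psi> z = y}"

definition archimedean_generator :: "(real \<Rightarrow> real) \<Rightarrow> bool" where
  "archimedean_generator \<psi> \<longleftrightarrow>
     continuous_on {0..} \<psi> \<and>
     (\<forall>z\<ge>0. \<psi> z \<in> {0..1}) \<and>
     (\<forall>a b. 0 \<le> a \<longrightarrow> a \<le> b \<longrightarrow> \<psi> b \<le> \<psi> a) \<and>
     \<psi> 0 = 1 \<and>
     (\<psi> \<longlongrightarrow> 0) at_top \<and>
     (\<forall>a b. 0 \<le> a \<longrightarrow> a < b \<longrightarrow> ereal b \<le> Inf {z::ereal. 0 \<le> z \<and> psiE \<psi> z = 0}
            \<longrightarrow> \<psi> b < \<psi> a)"

definition d_monotone :: "nat \<Rightarrow> (real \<Rightarrow> real) \<Rightarrow> bool" where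
  "d_monotone d \<psi> \<longleftrightarrow>
     (\<forall>k < d - 2. \<forall>z > 0. ((deriv ^^ k) \<psi> has_real_derivative (deriv ^^ Suc k) \<psi> z) (at z)) \<and>
     (\<forall>z > 0. 0 \<le> (-1) ^ (d - 2) * (deriv ^^ (d - 2)) \<psi> z) \<and>
     (\<forall>a b. 0 < a \<longrightarrow> a \<le> b \<longrightarrow>
        (-1) ^ (d - 2) * (deriv ^^ (d - 2)) \<psi> b \<le> (-1) ^ (d - 2) * (deriv ^^ (d - 2)) \<psi> a) \<and>
     convex_on {0<..} (\<lambda>z. (-1) ^ (d - 2) * (deriv ^^ (d - 2)) \<psi> z)"

definition left_deriv :: "(real \<Rightarrow> real) \<Rightarrow> real \<Rightarrow> real" where
  "left_deriv h z = Lim (at_left z) (\<lambda>w. (h z - h w) / (z - w))"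

definition Dm :: "nat \<Rightarrow> (real \<Rightarrow> real) \<Rightarrow> ereal \<Rightarrow> real" where
  "Dm d \<psi> z = (case z of ereal r \<Rightarrow> left_deriv ((deriv ^^ (d - 2)) \<psi>) r | _ \<Rightarrow> 0)"

definition cube :: "nat \<Rightarrow> (nat \<Rightarrow> real) set" where
  "cube n = PiE {..<n} (\<lambda>_. {0..1})"

definition Msum :: "(real \<Rightarrow> real) \<Rightarrow> nat \<Rightarrow> (nat \<Rightarrow> real) \<Rightarrow> ereal" where
  "Msum \<psi> n x = (\<Sum>i<n. phi \<psi> (x i))"

definition in_L0 :: "(real \<Rightarrow> real) \<Rightarrow> nat \<Rightarrow> (nat \<Rightarrow> real) \<Rightarrow> bool" where
  "in_L0 \<psi> m x \<longleftrightarrow> Msum \<psi> m x \<ge> phi \<psi> 0"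

definition f0 :: "(real \<Rightarrow> real) \<Rightarrow> nat \<Rightarrow> (nat \<Rightarrow> real) \<Rightarrow> real" where
  "f0 \<psi> m x = (if in_L0 \<psi> m x then 1 else psiE \<psi> (phi \<psi> 0 - Msum \<psi> m x))"

definition KC :: "nat \<Rightarrow> (real \<Rightarrow> real) \<Rightarrow> (nat \<Rightarrow> real) \<Rightarrow> real \<Rightarrow> real" where
  "KC d \<psi> x y =
     (if Min (x ` {..<d-1}) = 1 \<or> in_L0 \<psi> (d-1) x then 1
      else if y < f0 \<psi> (d-1) x then 0
      else Dm d \<psi> (Msum \<psi> (d-1) x + phi \<psi> y) / Dm d \<psi> (Msum \<psi> (d-1) x))"

definition KC_measure :: "nat \<Rightarrow> (real \<Rightarrow> real) \<Rightarrow> (nat \<Rightarrow> real) \<Rightarrow> real measure" where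
  "KC_measure d \<psi> x = interval_measure (\<lambda>y. if y < 0 then 0 else KC d \<psi> x (min y 1))"

end

theory Submission
  imports Defs
begin

text \<open>
  Push the margin forward by \<open>\<phi>\<close> in every coordinate. Writing \<open>F\<^sub>k\<close> for \<open>(-1)\<^sup>k \<psi>\<^sup>(\<^sup>k\<^sup>)\<close> if
  \<open>k \<le> d - 2\<close> and for \<open>(-1)\<^sup>d\<^sup>-\<^sup>1 D\<^sup>-\<psi>\<^sup>(\<^sup>d\<^sup>-\<^sup>2\<^sup>)\<close> if \<open>k = d - 1\<close>, each \<open>F\<^sub>k\<close> is non-negative,
  non-increasing, vanishes at infinity and, for \<open>k < d - 1\<close>, is the tail integral of its successor. Iterating the
  tail integrals, \<open>F\<^sub>d\<^sub>-\<^sub>1(s + z\<^sub>1 + \<dots> + z\<^sub>d\<^sub>-\<^sub>1)\<close> integrates over \<open>{z \<ge> t}\<close> to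
  \<open>\<psi>(s + t\<^sub>1 + \<dots> + t\<^sub>d\<^sub>-\<^sub>1)\<close>. For \<open>s = 0\<close> this says that \<open>F\<^sub>d\<^sub>-\<^sub>1(\<Sum>z)\<close> is the density of
  \<open>(\<phi>(X\<^sub>1), \<dots>, \<phi>(X\<^sub>d\<^sub>-\<^sub>1))\<close>. Multiplying this density by the kernel
  \<open>F\<^sub>d\<^sub>-\<^sub>1(\<Sum>z + \<phi>(y)) / F\<^sub>d\<^sub>-\<^sub>1(\<Sum>z)\<close> gives \<open>F\<^sub>d\<^sub>-\<^sub>1(\<Sum>z + \<phi>(y))\<close>, whose integral, by the case
  \<open>s = \<phi>(y)\<close>, is the copula itself.
\<close>

subsection \<open>Convex functions and their one-sided derivatives\<close>

text \<open>The top member of the chain is only the left derivative of a convex function. It may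
  jump, so the last tail integral is out of reach of the fundamental theorem of calculus. What
  survives is that the secant slopes of one member are squeezed between values of the next. This
  holds at smooth and at convex levels alike, and for a monotone integrand it already determines the
  integral. Signs are given only at order \<open>d - 2\<close> and decay only for
  \<open>\<psi>\<close>. Signs therefore travel down the chain, and decay travels up. The copula is
  known only through boxes with corner in the unit cube. Margin and joint law are therefore both
  identified by comparing box values with those of an explicitly built measure, after mass outside
  the cube has been excluded by means of boxes with one side at 0. In particular, the disintegration
  formula for arbitrary Borel \<open>G\<close> is never computed: the law composed of margin and
  kernel agrees with \<open>\<mu>\<close> on boxes, hence everywhere.\<close>

lemma eq_if_osc_le_antimono_increments:
  fixes g f :: "real \<Rightarrow> real"
  assumes "x \<le> y"
    and osc: "\<And>u v. x \<le> u \<Longrightarrow> u \<le> v \<Longrightarrow> v \<le> y \<Longrightarrow> \<bar>g u - g v\<bar> \<le> (f u - f v) * (v - u)"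
  shows "g x = g y"
proof -
  have bound: "\<bar>g x - g y\<bar> \<le> (f x - f y) * (y - x) / real (Suc n)" for n
  proof -
    \<comment> \<open>Equal pieces: the increments of \<open>f\<close> telescope, so the total
      oscillation of \<open>g\<close> is bounded by a fixed quantity divided by
      \<open>Suc n\<close>.\<close>
    define p where "p i = x + real i * ((y - x) / real (Suc n))" for i
    have step: "p (Suc i) - p i = (y - x) / real (Suc n)" for i
      unfolding p_def of_nat_Suc[of i] distrib_right by (simp only: mult_1)
    have p0: "p 0 = x" and pn: "p (Suc n) = y" by (simp_all add: p_def)
    have pm: "p i \<le> p (Suc i)" for i using step[of i] assms(1) by (smt (verit) divide_nonneg_nonneg of_nat_0_le_iff)
    have pmono: "i \<le> j \<Longrightarrow> p i \<le> p j" for i j by (rule lift_Suc_mono_le[of p, OF pm])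
    have "\<bar>g x - g y\<bar> = \<bar>\<Sum>i<Suc n. g (p i) - g (p (Suc i))\<bar>"
      by (subst sum_lessThan_telescope') (simp add: p0 pn)
    also have "\<dots> \<le> (\<Sum>i<Suc n. \<bar>g (p i) - g (p (Suc i))\<bar>)" by (rule sum_abs)
    also have "\<dots> \<le> (\<Sum>i<Suc n. (f (p i) - f (p (Suc i))) * ((y - x) / real (Suc n)))"
    proof (rule sum_mono)
      fix i assume "i \<in> {..<Suc n}"
      then have "x \<le> p i" "p (Suc i) \<le> y" using pmono[of 0 i] pmono[of "Suc i" "Suc n"] p0 pn by auto
      from osc[OF this(1) pm this(2)] show "\<bar>g (p i) - g (p (Suc i))\<bar> \<le> (f (p i) - f (p (Suc i))) * ((y - x) / real (Suc n))"
        by (simp only: step)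
    qed
    also have "\<dots> = (f x - f y) * ((y - x) / real (Suc n))"
      by (subst sum_distrib_right[symmetric], subst sum_lessThan_telescope') (simp add: p0 pn)
    finally show ?thesis by simp
  qed
  have "(\<lambda>n. (f x - f y) * (y - x) / real (Suc n)) \<longlonglongrightarrow> 0"
    by (rule LIMSEQ_Suc[OF lim_const_over_n])
  then have "\<bar>g x - g y\<bar> \<le> 0"
    using LIMSEQ_le_const bound by blast
  then show ?thesis by simp
qed

text \<open>The two inequalities say that \<open>- f z\<close> is a subgradient of \<open>g\<close>
  at every \<open>z > 0\<close>. This covers both \<open>f = - g'\<close> for convex smooth
  \<open>g\<close> and \<open>f = - left_deriv g\<close>, without continuity of \<open>f\<close> or
  differentiability of \<open>g\<close>.\<close>

definition neg_slope_between :: "(real \<Rightarrow> real) \<Rightarrow> (real \<Rightarrow> real) \<Rightarrow> bool" where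
  "neg_slope_between f g \<longleftrightarrow>
     (\<forall>x>0. 0 \<le> f x) \<and>
     (\<forall>x y. 0 < x \<longrightarrow> x \<le> y \<longrightarrow> f y * (y - x) \<le> g x - g y \<and> g x - g y \<le> f x * (y - x))"

lemma neg_slope_betweenD:
  assumes "neg_slope_between f g" "0 < x" "x \<le> y"
  shows "f y * (y - x) \<le> g x - g y" "g x - g y \<le> f x * (y - x)"
  using assms by (auto simp: neg_slope_between_def)

lemma neg_slope_between_antimono:
  assumes "neg_slope_between f g" "0 < x" "x \<le> y" shows "f y \<le> f x"
proof (cases "x = y")
  case False
  with neg_slope_betweenD[OF assms] assms(3) have "f y * (y - x) \<le> f x * (y - x)" "0 < y - x" by linarith+
  then show ?thesis by simp
qed simp

text \<open>Over \<open>[u, v]\<close> the decrease of \<open>g\<close> and the integral of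
  \<open>f\<close> both lie between \<open>f v * (v - u)\<close> and \<open>f u * (v - u)\<close>.
  Hence \<open>g\<close> plus the running integral has oscillation at most
  \<open>(f u - f v) * (v - u)\<close> and is constant.\<close>

lemma neg_slope_between_integral:
  assumes s: "neg_slope_between f g" and xy: "0 < x" "x \<le> y"
  shows "(f has_integral (g x - g y)) {x..y}"
proof -
  have anti: "f v \<le> f u" if "x \<le> u" "u \<le> v" for u v
    using neg_slope_between_antimono[OF s] that xy by simp
  have int: "f integrable_on {u..v}" if "x \<le> u" for u v
  proof -
    have "(\<lambda>z. - f z) integrable_on {u..v}"
      by (rule integrable_on_mono_on) (use that anti in \<open>auto simp: mono_on_def\<close>)
    from integrable_neg[OF this] show ?thesis by simp
  qed
  define I where "I u = integral {x..u} f" for u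
  have I: "I v - I u = integral {u..v} f" if "x \<le> u" "u \<le> v" for u v
    using Henstock_Kurzweil_Integration.integral_combine[of x u v f, OF that int] by (simp add: I_def)
  have bnd: "f v * (v - u) \<le> integral {u..v} f \<and> integral {u..v} f \<le> f u * (v - u)" if "x \<le> u" "u \<le> v" for u v
  proof -
    have c: "((\<lambda>_. c) has_integral c * (v - u)) {u..v}" for c :: real
      using has_integral_const_real[of c u v] that by (simp add: mult.commute)
    from int[OF that(1)] have i: "(f has_integral integral {u..v} f) {u..v}" by (rule integrable_integral)
    show ?thesis
      using has_integral_le[OF c i, of "f v"] has_integral_le[OF i c, of "f u"] anti that by auto
  qed
  have "g x + I x = g y + I y"
  proof (rule eq_if_osc_le_antimono_increments[OF xy(2), of "\<lambda>u. g u + I u" f])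
    fix u v assume uv: "x \<le> u" "u \<le> v" "v \<le> y"
    show "\<bar>g u + I u - (g v + I v)\<bar> \<le> (f u - f v) * (v - u)"
      using I[OF uv(1,2)] bnd[OF uv(1,2)] neg_slope_betweenD[OF s, of u v] uv xy
      unfolding left_diff_distrib[of "f u" "f v"] by linarith
  qed
  then have "integral {x..y} f = g x - g y" by (simp add: I_def)
  with int[of x y] show ?thesis by (metis integrable_integral order_refl)
qed

text \<open>Since \<open>f\<close> is non-increasing, \<open>g\<close> is Lipschitz with constant
  \<open>f (z/2)\<close> to the right of \<open>z/2\<close>; a neighbourhood of 0 must be avoided
  because \<open>f\<close> may be unbounded there.\<close>

lemma neg_slope_between_isCont:
  assumes s: "neg_slope_between f g" and z: "0 < z"
  shows "isCont g z"
proof -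
  have f0: "0 \<le> f (z/2)" using s z by (auto simp: neg_slope_between_def)
  have "\<forall>\<^sub>F w in at z. norm (g w - g z) \<le> f (z/2) * \<bar>w - z\<bar>"
    unfolding eventually_at
  proof (intro exI conjI ballI impI)
    show "0 < z/2" using z by simp
    fix w assume "w \<noteq> z \<and> dist w z < z/2"
    then have wz: "z / 2 < w" by (simp add: dist_real_def abs_if split: if_splits)
    have lip: "\<bar>g u - g v\<bar> \<le> f (z/2) * (v - u)" if "z/2 \<le> u" "u \<le> v" for u v
    proof -
      have "0 < u" "0 < v" "0 < z/2" using that z by auto
      then have "0 \<le> f v" "f u \<le> f (z/2)"
        using s neg_slope_between_antimono[OF s \<open>0 < z/2\<close> that(1)] by (auto simp: neg_slope_between_def)
      then have "0 \<le> f v * (v - u)" "f u * (v - u) \<le> f (z/2) * (v - u)"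
        using that by (auto intro: mult_right_mono)
      with neg_slope_betweenD[OF s \<open>0 < u\<close> that(2)] show ?thesis by linarith
    qed
    show "norm (g w - g z) \<le> f (z/2) * \<bar>w - z\<bar>"
      using lip[of w z] lip[of z w] wz z by (cases "w \<le> z") (auto simp: abs_minus_commute)
  qed
  moreover have "((\<lambda>w. f (z/2) * \<bar>w - z\<bar>) \<longlongrightarrow> f (z/2) * \<bar>z - z\<bar>) (at z)"
    by (intro tendsto_intros)
  ultimately have "((\<lambda>w. g w - g z) \<longlongrightarrow> 0) (at z)"
    by (intro Lim_null_comparison[of "\<lambda>w. g w - g z"]) auto
  then show ?thesis by (simp add: isCont_def LIM_zero_iff)
qed

lemma neg_slope_between_nn_integral:
  assumes s: "neg_slope_between f g"
    and c: "0 \<le> c" "(g \<longlongrightarrow> g c) (at_right c)"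
    and lim: "(g \<longlongrightarrow> 0) at_top"
    and meas: "(\<lambda>w. ennreal (f w) * indicator {c<..} w) \<in> borel_measurable borel"
  shows "(\<integral>\<^sup>+w. ennreal (f w) * indicator {c<..} w \<partial>lborel) = ennreal (g c)"
proof -
  \<comment> \<open>The left ends stay strictly above \<open>c\<close>: slope bounds hold at
    positive arguments only and \<open>c = 0\<close> is allowed. Right continuity of
    \<open>g\<close> at \<open>c\<close> recovers the value there.\<close>
  define A where "A n = {c + 1 / real (Suc n)..c + real (Suc n)}" for n
  have A_mono: "A i \<subseteq> A j" if "i \<le> j" for i j
  proof -
    have "1 / real (Suc j) \<le> 1 / real (Suc i)" using that by (intro divide_left_mono) auto
    then show ?thesis using that by (auto simp: A_def)
  qed
  have A_sub: "A n \<subseteq> {c<..}" for n by (auto simp: A_def intro: less_le_trans[rotated])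
  have A_un: "\<exists>n. w \<in> A n" if "c < w" for w
  proof -
    from that have "0 < w - c" by simp
    then obtain n1 where n1: "1 / real (Suc n1) < w - c" by (rule nat_approx_posE)
    obtain n2 :: nat where n2: "w - c < real n2" using reals_Archimedean2 by blast
    have "1 / real (Suc (max n1 n2)) \<le> 1 / real (Suc n1)" by (intro divide_left_mono) auto
    with n1 n2 have "w \<in> A (max n1 n2)" unfolding A_def by (auto simp: max_def)
    then show ?thesis ..
  qed
  have A_int: "(\<integral>\<^sup>+w. ennreal (f w) * indicator (A n) w \<partial>lborel)
      = ennreal (g (c + 1 / real (Suc n)) - g (c + real (Suc n)))" for n
  proof -
    have "1 / real (Suc n) \<le> 1" by simp
    moreover have "1 \<le> real (Suc n)" by simp
    ultimately have "c + 1 / real (Suc n) \<le> c + real (Suc n)" by linarith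
    moreover have p: "0 < c + 1 / real (Suc n)" using c by (simp add: add_nonneg_pos)
    ultimately show ?thesis unfolding A_def
      using s
      by (intro nn_integral_has_integral_lebesgue' neg_slope_between_integral[OF s])
         (auto simp: neg_slope_between_def)
  qed
  have ind: "indicator {c<..} w = (SUP n. indicator (A n) w :: ennreal)" for w
  proof (cases "c < w")
    case True
    with A_un obtain n where "w \<in> A n" by blast
    then have "1 \<le> (SUP n. indicator (A n) w :: ennreal)" by (intro SUP_upper2[of n]) auto
    moreover have "(SUP n. indicator (A n) w :: ennreal) \<le> 1" by (intro SUP_least) (auto simp: indicator_def)
    ultimately show ?thesis using True by (auto intro: antisym)
  next
    case False
    then have "w \<notin> A n" for n using A_sub[of n] by auto
    then show ?thesis using False by simp
  qed
  have "(\<integral>\<^sup>+w. ennreal (f w) * indicator {c<..} w \<partial>lborel)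
      = (\<integral>\<^sup>+w. (SUP n. ennreal (f w) * indicator (A n) w) \<partial>lborel)"
    by (simp only: ind SUP_mult_left_ennreal)
  also have "\<dots> = (SUP n. \<integral>\<^sup>+w. ennreal (f w) * indicator (A n) w \<partial>lborel)"
  proof (rule nn_integral_monotone_convergence_SUP)
    show "incseq (\<lambda>n w. ennreal (f w) * indicator (A n) w)"
      using A_mono by (auto simp: incseq_def le_fun_def intro!: mult_left_mono indicator_leI)
    fix n
    have meas': "(\<lambda>w. ennreal (f w) * indicator {c<..} w) \<in> borel_measurable lborel"
      unfolding measurable_lborel2 by (rule meas)
    have "(\<lambda>w. (ennreal (f w) * indicator {c<..} w) * indicator (A n) w) \<in> borel_measurable lborel"
      by (rule borel_measurable_times_ennreal[OF meas']) (simp add: A_def)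
    also have "(\<lambda>w. (ennreal (f w) * indicator {c<..} w) * indicator (A n) w) = (\<lambda>w. ennreal (f w) * indicator (A n) w)"
      using A_sub[of n] by (auto simp: fun_eq_iff indicator_def)
    finally show "(\<lambda>w. ennreal (f w) * indicator (A n) w) \<in> borel_measurable lborel" .
  qed
  also have "\<dots> = ennreal (g c)"
  proof (rule LIMSEQ_unique[OF LIMSEQ_SUP])
    show "incseq (\<lambda>n. \<integral>\<^sup>+w. ennreal (f w) * indicator (A n) w \<partial>lborel)"
      using A_mono by (auto simp: incseq_def intro!: nn_integral_mono mult_left_mono indicator_leI)
    have l1: "(\<lambda>n. g (c + 1 / real (Suc n))) \<longlonglongrightarrow> g c"
    proof (rule filterlim_compose[OF c(2)])
      have "(\<lambda>n. c + inverse (real (Suc n))) \<longlonglongrightarrow> c + 0"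
        by (intro tendsto_intros LIMSEQ_inverse_real_of_nat)
      then show "filterlim (\<lambda>n. c + 1 / real (Suc n)) (at_right c) sequentially"
        by (auto simp: filterlim_at inverse_eq_divide)
    qed
    have l2: "(\<lambda>n. g (c + real (Suc n))) \<longlonglongrightarrow> 0"
    proof (rule filterlim_compose[OF lim])
      have "filterlim (\<lambda>n. real (Suc n)) at_top sequentially"
        by (rule filterlim_compose[OF filterlim_real_sequentially filterlim_Suc])
      then show "filterlim (\<lambda>n. c + real (Suc n)) at_top sequentially"
        by (rule filterlim_tendsto_add_at_top[OF tendsto_const])
    qed
    show "(\<lambda>n. \<integral>\<^sup>+w. ennreal (f w) * indicator (A n) w \<partial>lborel) \<longlonglongrightarrow> ennreal (g c)"
      unfolding A_int using tendsto_ennrealI[OF tendsto_diff[OF l1 l2]] by simp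
  qed
  finally show ?thesis .
qed

text \<open>Past some point \<open>g s + e * s\<close> is non-increasing, so \<open>g\<close> drops
  below every bound; \<open>-1\<close> is just a convenient negative level.\<close>

lemma eventually_le_minus_one_if_deriv_le_neg:
  fixes g :: "real \<Rightarrow> real"
  assumes der: "\<And>s. 0 < s \<Longrightarrow> (g has_real_derivative g' s) (at s)"
    and e: "0 < e" "\<forall>\<^sub>F s in at_top. g' s \<le> - e"
  shows "\<forall>\<^sub>F s in at_top. g s \<le> -1"
proof -
  from e(2) obtain N0 where N0: "\<And>s. N0 \<le> s \<Longrightarrow> g' s \<le> - e" by (auto simp: eventually_at_top_linorder)
  define N where "N = max N0 1"
  have *: "g s + e * s \<le> g N + e * N" if "N \<le> s" for s
  proof (rule DERIV_nonpos_imp_nonincreasing[OF that])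
    fix x assume x: "N \<le> x" "x \<le> s"
    have "((\<lambda>s. g s + e * s) has_real_derivative g' x + e) (at x)"
      by (auto intro!: derivative_eq_intros der) (use x N_def in auto)
    moreover have "g' x + e \<le> 0" using N0[of x] x N_def by auto
    ultimately show "\<exists>y. ((\<lambda>s. g s + e * s) has_real_derivative y) (at x) \<and> y \<le> 0" by blast
  qed
  show ?thesis
  proof (rule eventually_at_top_linorderI[of "max N ((g N + e * N + 1) / e)"])
    fix s assume s: "max N ((g N + e * N + 1) / e) \<le> s"
    then have "(g N + e * N + 1) / e \<le> s" by simp
    then have "g N + e * N + 1 \<le> e * s" using e(1) by (simp add: pos_divide_le_eq mult.commute)
    with *[of s] s show "g s \<le> -1" by simp
  qed
qed

text \<open>By convexity the negated secant slopes \<open>q s w\<close> decrease as \<open>w\<close>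
  increases to \<open>s\<close>, and they are non-negative because \<open>g\<close> is
  non-increasing. The left derivative therefore exists and equals minus their infimum
  \<open>L s\<close>; all three claims are statements about this infimum.\<close>

lemma convex_antimono_left_deriv:
  fixes g :: "real \<Rightarrow> real"
  assumes cvx: "convex_on {0<..} g" and anti: "\<And>a b. 0 < a \<Longrightarrow> a \<le> b \<Longrightarrow> g b \<le> g a"
  shows left_deriv_tendsto: "0 < s \<Longrightarrow> ((\<lambda>w. (g s - g w) / (s - w)) \<longlongrightarrow> left_deriv g s) (at_left s)"
    and neg_slope_between_left_deriv: "neg_slope_between (\<lambda>s. - left_deriv g s) g"
    and left_deriv_left_approx: "0 < s \<Longrightarrow> 0 < e \<Longrightarrow> \<forall>\<^sub>F t in at_left s. - left_deriv g t < - left_deriv g s + e"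
proof -
  define q where "q s w = (g w - g s) / (s - w)" for s w
  define L where "L s = Inf (q s ` {0<..<s})" for s
  have q_nonneg: "0 \<le> q s w" if "0 < w" "w < s" for s w
    using anti[of w s] that by (simp add: q_def)
  have q_mono: "q s w' \<le> q s w" if "0 < w" "w < w'" "w' < s" for s w w'
    using convex_on_slope_le(2)[OF cvx, of w s w'] that
    unfolding q_def by (simp add: minus_divide_right[symmetric] minus_diff_eq[symmetric, of s] del: minus_diff_eq)
  have bdd: "bdd_below (q s ` {0<..<s})" for s
    using q_nonneg by (intro bdd_belowI[of _ 0]) auto
  have L_le: "L s \<le> q s w" if "0 < w" "w < s" for s w
    unfolding L_def using that bdd by (intro cInf_lower) auto
  have L_ge: "c \<le> L s" if "0 < s" "\<And>w. 0 < w \<Longrightarrow> w < s \<Longrightarrow> c \<le> q s w" for c s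
    unfolding L_def using that by (intro cInf_greatest) auto
  have L_approx: "\<exists>w. 0 < w \<and> w < s \<and> q s w < L s + e" if "0 < s" "0 < e" for s e
  proof (rule ccontr)
    assume "\<not> ?thesis"
    then have "L s + e \<le> L s" using that by (intro L_ge) (meson not_less)+
    with that show False by simp
  qed
  have lim: "((\<lambda>w. (g s - g w) / (s - w)) \<longlongrightarrow> - L s) (at_left s)" if s: "0 < s" for s
  proof -
    have "((q s) \<longlongrightarrow> L s) (at_left s)"
    proof (rule order_tendstoI)
      fix a assume "a < L s"
      then show "\<forall>\<^sub>F w in at_left s. a < q s w"
        using L_le[of _ s] s by (auto simp: eventually_at_left_field intro!: exI[of _ 0] intro: less_le_trans)
    next
      fix a assume "L s < a"
      with L_approx[OF s, of "a - L s"] obtain w where w: "0 < w" "w < s" "q s w < a" by auto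
      then show "\<forall>\<^sub>F w in at_left s. q s w < a"
        using q_mono[of w _ s] by (auto simp: eventually_at_left_field intro!: exI[of _ w] intro: le_less_trans)
    qed
    from tendsto_minus[OF this] show ?thesis by (simp add: q_def minus_divide_left)
  qed
  have ld: "left_deriv g s = - L s" if "0 < s" for s
    unfolding left_deriv_def by (rule tendsto_Lim[OF _ lim[OF that]]) simp
  then show "0 < s \<Longrightarrow> ((\<lambda>w. (g s - g w) / (s - w)) \<longlongrightarrow> left_deriv g s) (at_left s)"
    using lim by simp
  show nsb: "neg_slope_between (\<lambda>s. - left_deriv g s) g"
    unfolding neg_slope_between_def
  proof (intro conjI allI impI)
    fix x :: real assume "0 < x"
    then show "0 \<le> - left_deriv g x" using L_ge[of x 0] q_nonneg by (simp add: ld)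
  next
    fix x y :: real assume xy: "0 < x" "x \<le> y"
    show "- left_deriv g y * (y - x) \<le> g x - g y"
      using L_le[of x y] xy by (cases "x = y") (auto simp: ld q_def pos_le_divide_eq)
    show "g x - g y \<le> - left_deriv g x * (y - x)"
    proof (cases "x = y")
      case False
      \<comment> \<open>Three-chord inequality: every chord ending at \<open>x\<close> falls at
        least as steeply as the chord from \<open>x\<close> to \<open>y\<close>.\<close>
      have "(g x - g y) / (y - x) \<le> L x"
      proof (rule L_ge[OF xy(1)])
        fix w assume w: "0 < w" "w < x"
        from order_trans[OF convex_on_slope_le[OF cvx, of w y x]] w xy False
        have "(g w - g x) / (w - x) \<le> (g x - g y) / (x - y)" by simp
        moreover have "(g w - g x) / (w - x) = - q x w"
          unfolding q_def by (subst minus_diff_eq[symmetric, of x w]) (simp only: minus_divide_right)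
        moreover have "(g x - g y) / (x - y) = - ((g x - g y) / (y - x))"
          by (subst minus_diff_eq[symmetric, of x y]) (simp only: minus_divide_right minus_diff_eq)
        ultimately show "(g x - g y) / (y - x) \<le> q x w" by simp
      qed
      with xy False show ?thesis by (simp add: ld pos_divide_le_eq)
    qed simp
  qed
  show "\<forall>\<^sub>F t in at_left s. - left_deriv g t < - left_deriv g s + e" if s: "0 < s" "0 < e"
  proof -
    \<comment> \<open>Freeze one chord that nearly attains the infimum at \<open>s\<close>. Its
      slope depends continuously on the right end point \<open>t\<close>, and \<open>L t\<close> is
      below it.\<close>
    from L_approx[OF s] obtain w where w: "0 < w" "w < s" "q s w < L s + e" by blast
    have "((\<lambda>t. (g w - g t) / (t - w)) \<longlongrightarrow> q s w) (at_left s)"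
    proof -
      have "(g \<longlongrightarrow> g s) (at_left s)"
        using neg_slope_between_isCont[OF nsb s(1)] by (simp add: isCont_def filterlim_at_split)
      then show ?thesis unfolding q_def using w by (intro tendsto_intros) auto
    qed
    then have "\<forall>\<^sub>F t in at_left s. (g w - g t) / (t - w) < L s + e" using w(3) by (rule order_tendstoD)
    moreover have "\<forall>\<^sub>F t in at_left s. w < t" using w by (auto simp: eventually_at_left_field)
    ultimately show ?thesis
    proof eventually_elim
      case (elim t)
      with L_le[of w t] w show ?case by (simp add: ld q_def s)
    qed
  qed
qed

subsection \<open>Archimedean generators\<close>

lemma psiE_simps [simp]:
  "0 \<le> r \<Longrightarrow> psiE \<psi> (ereal r) = \<psi> r" "r < 0 \<Longrightarrow> psiE \<psi> (ereal r) = 1" "psiE \<psi> \<infinity> = 0" "psiE \<psi> (-\<infinity>) = 1"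
  by (auto simp: psiE_def)

locale generator =
  fixes \<psi> :: "real \<Rightarrow> real"
  assumes gen: "archimedean_generator \<psi>"
begin

lemma psi_cont: "continuous_on {0..} \<psi>"
  and psi_nonneg: "0 \<le> z \<Longrightarrow> 0 \<le> \<psi> z"
  and psi_le_1: "0 \<le> z \<Longrightarrow> \<psi> z \<le> 1"
  and psi_antimono: "0 \<le> a \<Longrightarrow> a \<le> b \<Longrightarrow> \<psi> b \<le> \<psi> a"
  and psi_0 [simp]: "\<psi> 0 = 1"
  and psi_lim: "(\<psi> \<longlongrightarrow> 0) at_top"
  and psi_strict: "0 \<le> a \<Longrightarrow> a < b \<Longrightarrow> ereal b \<le> phi \<psi> 0 \<Longrightarrow> \<psi> b < \<psi> a"
  using gen unfolding archimedean_generator_def phi_def by auto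

lemma psi_right_cont: "0 \<le> z \<Longrightarrow> (\<psi> \<longlongrightarrow> \<psi> z) (at_right z)"
  by (rule tendsto_within_subset[of \<psi> _ z "{0..}"]) (use psi_cont in \<open>auto simp: continuous_on_def\<close>)

lemma phi_nonneg: "0 \<le> phi \<psi> u"
  unfolding phi_def by (intro Inf_greatest) auto

lemma phi_le: "0 \<le> z \<Longrightarrow> phi \<psi> (\<psi> z) \<le> ereal z"
  unfolding phi_def by (intro Inf_lower) auto

lemma psi_attains:
  assumes "0 \<le> z" "\<psi> z \<le> u" "u \<le> 1"
  obtains w where "0 \<le> w" "w \<le> z" "\<psi> w = u"
  using IVT2'[of \<psi> z u 0] assms continuous_on_subset[OF psi_cont, of "{0..z}"] by auto

text \<open>The Galois connection from which most facts on \<open>phi\<close> follow, including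
  \<open>u = 0\<close> with \<open>phi \<psi> 0 = \<infinity>\<close>. One direction is the
  intermediate value theorem, the other is right continuity of \<open>\<psi>\<close>.\<close>

lemma psi_le_iff:
  assumes z: "0 \<le> z" and u: "0 \<le> u" "u \<le> 1"
  shows "\<psi> z \<le> u \<longleftrightarrow> phi \<psi> u \<le> ereal z"
proof
  assume "\<psi> z \<le> u"
  with psi_attains[OF z _ u(2)] obtain w where "0 \<le> w" "w \<le> z" "\<psi> w = u" by blast
  then show "phi \<psi> u \<le> ereal z" using phi_le[of w] by (metis ereal_less_eq(3) order_trans)
next
  assume le: "phi \<psi> u \<le> ereal z"
  \<comment> \<open>The infimum is not yet known to be attained, so the bound is shown strictly to
    the right of \<open>z\<close> first.\<close>
  have "\<psi> v \<le> u" if "z < v" for v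
  proof -
    from le that have "phi \<psi> u < ereal v" by (simp add: le_less_trans)
    then obtain w where w: "w < ereal v" "0 \<le> w" "psiE \<psi> w = u" unfolding phi_def Inf_less_iff by blast
    then obtain r where "w = ereal r" by (cases w) auto
    with w psi_antimono[of r v] show ?thesis by auto
  qed
  then have "\<forall>\<^sub>F v in at_right z. \<psi> v \<le> u" by (auto simp: eventually_at_right_field intro: gt_ex)
  moreover have "(\<psi> \<longlongrightarrow> \<psi> z) (at_right z)"
    using z by (intro psi_right_cont)
  ultimately show "\<psi> z \<le> u" by (intro tendsto_upperbound[of \<psi> _ "at_right z"]) auto
qed

lemma phi_psi:
  assumes z: "0 \<le> z" "ereal z \<le> phi \<psi> 0"
  shows "phi \<psi> (\<psi> z) = ereal z"
proof (rule antisym[OF phi_le[OF z(1)]], rule ccontr)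
  assume "\<not> ereal z \<le> phi \<psi> (\<psi> z)"
  then obtain w where w: "w < ereal z" "0 \<le> w" "psiE \<psi> w = \<psi> z" unfolding phi_def not_le Inf_less_iff by blast
  then obtain r where "w = ereal r" by (cases w) auto
  with w psi_strict[of r z] z show False by auto
qed

text \<open>A finite infimum is attained by the intermediate value theorem. If it is infinite,
  \<open>\<psi>\<close> stays above \<open>u\<close> while tending to 0, so \<open>u = 0\<close>,
  which is the value of \<open>psiE\<close> at infinity.\<close>

lemma psiE_phi:
  assumes u: "0 \<le> u" "u \<le> 1"
  shows "psiE \<psi> (phi \<psi> u) = u"
proof (cases "phi \<psi> u")
  case (real r)
  with phi_nonneg[of u] have r: "0 \<le> r" by simp
  with psi_le_iff[OF r u] real have le: "\<psi> r \<le> u" by simp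
  from psi_attains[OF r le u(2)] obtain w where w: "0 \<le> w" "w \<le> r" "\<psi> w = u" by blast
  with phi_le[of w] real have "w = r" by simp
  with w real show ?thesis by simp
next
  case PInf
  then have "u < \<psi> z" if "0 \<le> z" for z using psi_le_iff[OF that u] by auto
  then have "\<forall>\<^sub>F z in at_top. u \<le> \<psi> z" by (intro eventually_at_top_linorderI[of 0]) (auto intro: less_imp_le)
  with psi_lim have "u \<le> 0" by (intro tendsto_lowerbound) auto
  with u PInf show ?thesis by simp
next
  case MInf
  with phi_nonneg[of u] show ?thesis by simp
qed

lemma phi_antimono:
  assumes "0 \<le> u" "u \<le> v" "v \<le> 1"
  shows "phi \<psi> v \<le> phi \<psi> u"
proof (cases "phi \<psi> u")
  case (real r)
  with phi_nonneg[of u] have r: "0 \<le> r" by simp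
  then show ?thesis using psi_le_iff[OF r, of u] psi_le_iff[OF r, of v] assms real by auto
qed (use phi_nonneg[of u] in auto)

lemma phi_1 [simp]: "phi \<psi> 1 = 0"
  using phi_le[of 0] phi_nonneg[of 1] by (simp add: zero_ereal_def)

lemma phi_eq_0_iff: "0 \<le> u \<Longrightarrow> u \<le> 1 \<Longrightarrow> phi \<psi> u = 0 \<longleftrightarrow> u = 1"
  using psi_le_iff[of 0 u] phi_nonneg[of u] by (auto simp: zero_ereal_def[symmetric])

lemma phi_0_pos: "0 < phi \<psi> 0"
  using phi_eq_0_iff[of 0] phi_nonneg[of 0] by (auto simp: less_le)

lemma psi_eq_0:
  assumes "phi \<psi> 0 \<le> ereal z"
  shows "\<psi> z = 0"
proof -
  have z: "0 \<le> z" using order_trans[OF phi_nonneg assms] by simp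
  then show ?thesis using psi_le_iff[OF z, of 0] psi_nonneg[OF z] assms by simp
qed

lemma psiE_antimono: "0 \<le> a \<Longrightarrow> a \<le> b \<Longrightarrow> psiE \<psi> b \<le> psiE \<psi> a"
  by (cases a; cases b) (auto intro: psi_antimono psi_nonneg)

text \<open>Turns the case \<open>y < f0\<close> of the kernel into a condition on the argument of
  the numerator. For \<open>phi \<psi> 0 = \<infinity>\<close> both sides are false.\<close>

lemma psiE_phi0_minus:
  assumes S: "0 < S" "ereal S < phi \<psi> 0" and y: "0 \<le> y" "y \<le> 1"
  shows "y < psiE \<psi> (phi \<psi> 0 - ereal S) \<longleftrightarrow> phi \<psi> 0 < ereal S + phi \<psi> y"
proof (cases "phi \<psi> 0")
  case (real r)
  with S have r: "0 \<le> r - S" by simp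
  have "y < \<psi> (r - S) \<longleftrightarrow> ereal (r - S) < phi \<psi> y" using psi_le_iff[OF r y] by auto
  also have "\<dots> \<longleftrightarrow> ereal r < ereal S + phi \<psi> y"
    by (cases "phi \<psi> y") auto
  finally show ?thesis using real r by simp
qed (use y phi_0_pos in auto)

end

subsection \<open>The derivatives of a d-monotone generator\<close>

text \<open>Values at non-positive arguments are chosen so that every member is Borel measurable.\<close>

definition wchain :: "nat \<Rightarrow> (real \<Rightarrow> real) \<Rightarrow> nat \<Rightarrow> real \<Rightarrow> real" where
  "wchain d \<psi> k s =
     (if k = 0 then psiE \<psi> (ereal s)
      else if s \<le> 0 then 0
      else if k \<le> d - 2 then (-1) ^ k * (deriv ^^ k) \<psi> s
      else (-1) ^ (d - 1) * left_deriv ((deriv ^^ (d - 2)) \<psi>) s)"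

locale d_monotone_generator = generator +
  fixes d :: nat
  assumes d3: "3 \<le> d" and dmon: "d_monotone d \<psi>"
begin

abbreviation F where "F \<equiv> wchain d \<psi>"

lemma F_0 [simp]: "F 0 s = psiE \<psi> (ereal s)"
  by (simp add: wchain_def)

lemma F_eq_deriv: "k \<le> d - 2 \<Longrightarrow> 0 < s \<Longrightarrow> F k s = (-1) ^ k * (deriv ^^ k) \<psi> s"
  by (simp add: wchain_def)

lemma F_deriv:
  assumes "k < d - 2" "0 < s"
  shows "(F k has_real_derivative - F (Suc k) s) (at s)"
proof (rule has_field_derivative_transform_within_open[of _ _ s "{0<..}"])
  have "((deriv ^^ k) \<psi> has_real_derivative (deriv ^^ Suc k) \<psi> s) (at s)"
    using dmon assms by (auto simp: d_monotone_def)
  from DERIV_cmult[OF this, of "(-1) ^ k"]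
  show "((\<lambda>s. (-1) ^ k * (deriv ^^ k) \<psi> s) has_real_derivative - F (Suc k) s) (at s)"
    using assms by (simp add: F_eq_deriv)
qed (use assms in \<open>auto simp: F_eq_deriv\<close>)

text \<open>If \<open>F\<^sub>k\<^sub>+\<^sub>1\<close> stayed away from 0, integration would make \<open>F\<^sub>k\<close> diverge, and so on down to \<open>\<psi>\<close>.\<close>

lemma F_not_bounded_away:
  "k \<le> d - 2 \<Longrightarrow> 0 < e \<Longrightarrow> \<not> (\<forall>\<^sub>F s in at_top. e \<le> F k s) \<and> \<not> (\<forall>\<^sub>F s in at_top. F k s \<le> - e)"
proof (induction k arbitrary: e)
  case 0
  have "\<forall>\<^sub>F s in at_top. \<psi> s = F 0 s" by (rule eventually_at_top_linorderI[of 0]) simp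
  from Lim_transform_eventually[OF psi_lim this] have lim: "(F 0 \<longlongrightarrow> 0) at_top" .
  show ?case
    using tendsto_lowerbound[OF lim, of e] tendsto_upperbound[OF lim, of "- e"] 0 by auto
next
  case (Suc k)
  have der: "0 < s \<Longrightarrow> (F k has_real_derivative - F (Suc k) s) (at s)" for s using F_deriv Suc.prems by simp
  then have der': "0 < s \<Longrightarrow> ((\<lambda>s. - F k s) has_real_derivative F (Suc k) s) (at s)" for s
    using DERIV_minus[OF der] by fastforce
  have IH: "\<not> (\<forall>\<^sub>F s in at_top. 1 \<le> F k s)" "\<not> (\<forall>\<^sub>F s in at_top. F k s \<le> - 1)"
    using Suc.IH[of 1] Suc.prems by auto
  show ?case
  proof (intro conjI notI)
    assume "\<forall>\<^sub>F s in at_top. e \<le> F (Suc k) s"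
    then have "\<forall>\<^sub>F s in at_top. - F (Suc k) s \<le> - e" by simp
    from eventually_le_minus_one_if_deriv_le_neg[OF der Suc.prems(2) this] IH(2) show False by simp
  next
    assume "\<forall>\<^sub>F s in at_top. F (Suc k) s \<le> - e"
    from eventually_le_minus_one_if_deriv_le_neg[OF der' Suc.prems(2) this] IH(1) show False by simp
  qed
qed

lemma F_top_facts:
  "0 < z \<Longrightarrow> 0 \<le> F (d - 2) z"
  "0 < a \<Longrightarrow> a \<le> b \<Longrightarrow> F (d - 2) b \<le> F (d - 2) a"
  "convex_on {0<..} (F (d - 2))"
proof -
  show "0 < z \<Longrightarrow> 0 \<le> F (d - 2) z" "0 < a \<Longrightarrow> a \<le> b \<Longrightarrow> F (d - 2) b \<le> F (d - 2) a"
    using dmon by (auto simp: d_monotone_def F_eq_deriv)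
  have "convex_on {0<..} (\<lambda>z. (-1) ^ (d - 2) * (deriv ^^ (d - 2)) \<psi> z)" using dmon by (simp add: d_monotone_def)
  then show "convex_on {0<..} (F (d - 2))"
    using convexD[of "{0<..} :: real set"] by (auto simp: convex_on_def F_eq_deriv)
qed

text \<open>Downward from order \<open>d - 2\<close>: if \<open>F (Suc k)\<close> is non-negative
  then \<open>F k\<close> is non-increasing, so a negative value of \<open>F k\<close> would persist
  up to infinity, which \<open>F_not_bounded_away\<close> excludes.\<close>

lemma F_nonneg_aux: "k \<le> d - 2 \<Longrightarrow> (\<forall>z>0. 0 \<le> F k z) \<and> (\<forall>a b. 0 < a \<longrightarrow> a \<le> b \<longrightarrow> F k b \<le> F k a)"
proof (induction k rule: inc_induct)
  case base
  then show ?case using F_top_facts by blast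
next
  case (step k)
  have anti: "F k b \<le> F k a" if "0 < a" "a \<le> b" for a b
  proof (rule DERIV_nonpos_imp_nonincreasing[OF that(2)])
    fix x assume "a \<le> x" "x \<le> b"
    with that have "0 < x" by simp
    then show "\<exists>y. (F k has_real_derivative y) (at x) \<and> y \<le> 0"
      using F_deriv[of k x] step by (intro exI[of _ "- F (Suc k) x"]) auto
  qed
  have "0 \<le> F k z" if z: "0 < z" for z
  proof (rule ccontr)
    assume "\<not> 0 \<le> F k z"
    moreover have "\<forall>\<^sub>F s in at_top. F k s \<le> - (- F k z)"
      using anti[OF z] by (intro eventually_at_top_linorderI[of z]) auto
    ultimately show False using F_not_bounded_away[of k "- F k z"] step by auto
  qed
  with anti show ?case by blast
qed

text \<open>\<open>left_deriv\<close> is a \<open>Lim\<close> and has meaning only where the limit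
  exists. Convexity provides it for the signed function \<open>F (d - 2)\<close>; it is then
  transferred to the unsigned derivative.\<close>

lemma F_top_eq_left_deriv:
  assumes s: "0 < s"
  shows "F (d - 1) s = - left_deriv (F (d - 2)) s"
  proof -
    define g where "g = (deriv ^^ (d - 2)) \<psi>"
    have ev: "\<forall>\<^sub>F w in at_left s. (-1) ^ (d - 2) * ((F (d - 2) s - F (d - 2) w) / (s - w)) = (g s - g w) / (s - w)"
    proof -
      have sq: "(-1) ^ (d - 2) * ((-1) ^ (d - 2) * c) = (c :: real)" for c
        by (simp add: mult.assoc[symmetric] power_mult_distrib[symmetric])
      have "\<forall>\<^sub>F w in at_left s. 0 < w" using s by (auto simp: eventually_at_left_field)
      then show ?thesis
      proof eventually_elim
        case (elim w)
        have "F (d - 2) s - F (d - 2) w = (-1) ^ (d - 2) * (g s - g w)"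
          using s elim by (simp add: F_eq_deriv g_def right_diff_distrib)
        then show ?case by (simp add: sq)
      qed
    qed
    have "((\<lambda>w. (-1) ^ (d - 2) * ((F (d - 2) s - F (d - 2) w) / (s - w))) \<longlongrightarrow> (-1) ^ (d - 2) * left_deriv (F (d - 2)) s) (at_left s)"
      by (intro tendsto_mult_left left_deriv_tendsto F_top_facts s)
    from Lim_transform_eventually[OF this ev]
    have "left_deriv g s = (-1) ^ (d - 2) * left_deriv (F (d - 2)) s"
      unfolding left_deriv_def[of g] by (intro tendsto_Lim) auto
    moreover have "(-1) ^ (d - 1) * ((-1) ^ (d - 2) * c) = - (c :: real)" for c
    proof -
      have "d - 1 = Suc (d - 2)" using d3 by simp
      then show ?thesis by (simp add: mult.assoc[symmetric] power_mult_distrib[symmetric])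
    qed
    moreover have "F (d - 1) s = (-1) ^ (d - 1) * left_deriv g s"
    proof -
      have "d - 1 \<noteq> 0" "\<not> d - 1 \<le> d - 2" using d3 by auto
      then show ?thesis using s unfolding wchain_def g_def by simp
    qed
    ultimately show ?thesis by simp
  qed

text \<open>Below order \<open>d - 2\<close> this is the mean value theorem with a monotone
  derivative; at order \<open>d - 2\<close> it is the convex case.\<close>

lemma F_slope:
  assumes "k < d - 1"
  shows "neg_slope_between (F (Suc k)) (F k)"
proof (cases "k < d - 2")
  case True
  with F_nonneg_aux[of "Suc k"] have nn: "\<And>z. 0 < z \<Longrightarrow> 0 \<le> F (Suc k) z"
    and anti: "\<And>a b. 0 < a \<Longrightarrow> a \<le> b \<Longrightarrow> F (Suc k) b \<le> F (Suc k) a" by auto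
  show ?thesis unfolding neg_slope_between_def
  proof (intro conjI allI impI)
    fix x y :: real assume xy: "0 < x" "x \<le> y"
    have *: "F (Suc k) y * (y - x) \<le> F k x - F k y \<and> F k x - F k y \<le> F (Suc k) x * (y - x)"
    proof (cases "x = y")
      case False
      with xy have "x < y" by simp
      from MVT2[OF this, of "F k" "\<lambda>s. - F (Suc k) s"] F_deriv[OF True] xy
      obtain z where z: "x < z" "z < y" "F k y - F k x = (y - x) * - F (Suc k) z" by auto
      then have "F k x - F k y = F (Suc k) z * (y - x)" by (simp add: algebra_simps)
      then show ?thesis using anti[of x z] anti[of z y] z xy by (auto intro!: mult_right_mono)
    qed simp
    then show "F (Suc k) y * (y - x) \<le> F k x - F k y" "F k x - F k y \<le> F (Suc k) x * (y - x)" by auto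
  qed (rule nn)
next
  case False
  with assms have k: "k = d - 2" "Suc k = d - 1" by auto
  have "neg_slope_between (\<lambda>s. - left_deriv (F (d - 2)) s) (F (d - 2))"
    by (intro neg_slope_between_left_deriv F_top_facts)
  moreover have "F (Suc k) = F (d - 1)" "F k = F (d - 2)" using k by simp_all
  ultimately show ?thesis unfolding neg_slope_between_def by (simp add: F_top_eq_left_deriv del: One_nat_def)
qed

lemma F_nonneg: "k \<le> d - 1 \<Longrightarrow> 0 < s \<Longrightarrow> 0 \<le> F k s"
  using F_slope[of "k - 1"] F_nonneg_aux[of 0] d3 by (cases k) (auto simp: neg_slope_between_def)

lemma F_antimono: "k \<le> d - 1 \<Longrightarrow> 0 < a \<Longrightarrow> a \<le> b \<Longrightarrow> F k b \<le> F k a"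
proof (cases k)
  case 0
  then show "0 < a \<Longrightarrow> a \<le> b \<Longrightarrow> F k b \<le> F k a" using psi_antimono[of a b] by simp
next
  case (Suc j)
  then show "k \<le> d - 1 \<Longrightarrow> 0 < a \<Longrightarrow> a \<le> b \<Longrightarrow> F k b \<le> F k a"
    using neg_slope_between_antimono[OF F_slope[of j]] by simp
qed

lemma F_lim:
  assumes "k \<le> d - 1"
  shows "(F k \<longlongrightarrow> 0) at_top"
proof (rule order_tendstoI)
  fix e :: real assume "e < 0"
  then show "\<forall>\<^sub>F s in at_top. e < F k s"
    using F_nonneg[OF assms] by (intro eventually_at_top_linorderI[of 1]) (auto intro: less_le_trans)
next
  fix e :: real assume e: "0 < e"
  have "\<exists>s>0. F k s < e"
  proof (cases "k \<le> d - 2")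
    case True
    show ?thesis
    proof (rule ccontr)
      assume "\<not> ?thesis"
      then have "\<forall>\<^sub>F s in at_top. e \<le> F k s" by (intro eventually_at_top_linorderI[of 1]) (meson not_less less_le_trans zero_less_one)
      with F_not_bounded_away[OF True e] show False by blast
    qed
  next
    case False
    with assms have k: "k = Suc (d - 2)" by simp
    \<comment> \<open>Chosen so that \<open>e * (y - 1)\<close> is \<open>F (d - 2) 1 + 1\<close>,
      just more than the total decrease available to \<open>F (d - 2)\<close> after 1.\<close>
    define y where "y = 1 + (F (d - 2) 1 + 1) / e"
    have n: "0 \<le> F (d - 2) 1" using F_nonneg[of "d - 2" 1] d3 by simp
    with e have y: "1 < y" by (simp add: y_def)
    moreover have "d - 2 < d - 1" using d3 by simp
    ultimately have "F k y * (y - 1) \<le> F (d - 2) 1"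
      using neg_slope_betweenD(1)[OF F_slope[of "d - 2"], of 1 y] F_nonneg[of "d - 2" y] unfolding k by simp
    also have "\<dots> < e * (y - 1)" using e by (simp add: y_def)
    finally have "F k y < e" using y by simp
    with y show ?thesis by (intro exI[of _ y]) auto
  qed
  then obtain s0 where "0 < s0" "F k s0 < e" by blast
  then show "\<forall>\<^sub>F s in at_top. F k s < e"
    using F_antimono[OF assms] by (intro eventually_at_top_linorderI[of s0]) (auto intro: le_less_trans)
qed

section \<open>Zeros and positivity of the chain\<close>

lemma F_eq_0:
  "k \<le> d - 1 \<Longrightarrow> phi \<psi> 0 < ereal s \<Longrightarrow> F k s = 0"
proof (induction k arbitrary: s)
  case 0
  then have "0 < s" using less_trans[OF phi_0_pos, of "ereal s"] by (simp add: zero_ereal_def)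
  then show ?case using psi_eq_0[of s] 0 by simp
next
  case (Suc k)
  \<comment> \<open>The strict hypothesis leaves room for \<open>r\<close>: \<open>F k\<close>
    vanishes at both \<open>r\<close> and \<open>s\<close>, so its secant slope there is 0.\<close>
  from Suc.prems(2) obtain r where r: "phi \<psi> 0 < ereal r" "r < s"
    using ereal_dense2[OF Suc.prems(2)] by auto
  then have r0: "0 < r" using less_trans[OF phi_0_pos r(1)] by (simp add: zero_ereal_def)
  with neg_slope_betweenD(1)[OF F_slope[of k] r0, of s] Suc.IH[of r] Suc.IH[of s] Suc.prems r
  have "F (Suc k) s * (s - r) \<le> 0" by simp
  then have "F (Suc k) s \<le> 0" using r by (simp add: mult_le_0_iff)
  with F_nonneg[OF Suc.prems(1), of s] r r0 show ?case by simp
qed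

text \<open>Makes the denominator of the kernel non-zero. A zero of the top member would persist to
  the right; each lower member would then be constant there, hence 0 by its limit, and finally
  \<open>\<psi> S = 0\<close> with \<open>S\<close> below \<open>phi \<psi> 0\<close>.\<close>

lemma F_top_pos:
  assumes S: "0 < S" "ereal S < phi \<psi> 0"
  shows "0 < F (d - 1) S"
proof (rule ccontr)
  assume "\<not> 0 < F (d - 1) S"
  then have top: "F (d - 1) y = 0" if "S \<le> y" for y
    using F_antimono[of "d - 1" S y] F_nonneg[of "d - 1" y] S that by simp
  have "\<forall>y\<ge>S. F k y = 0" if "k \<le> d - 1" for k
    using that
  proof (induction k rule: inc_induct)
    case (step k)
    show ?case
    proof (intro allI impI)
      fix y assume y: "S \<le> y"
      have "F k z = F k y" if "y \<le> z" for z
        using neg_slope_betweenD[OF F_slope[of k], of y z] step y that S by auto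
      then have "(F k \<longlongrightarrow> F k y) at_top"
        by (intro tendsto_eventually eventually_at_top_linorderI[of y])
      moreover have "(F k \<longlongrightarrow> 0) at_top" using step by (intro F_lim) simp
      ultimately show "F k y = 0" by (rule tendsto_unique[OF trivial_limit_at_top_linorder])
    qed
  qed (use top in blast)
  from this[of 0] S have "\<psi> S = 0" by auto
  with psi_le_iff[of S 0] S show False by auto
qed

text \<open>As \<open>phi\<close> is non-increasing, right continuity of the kernel in
  \<open>y\<close> calls for control of the top member from the left.\<close>

lemma F_top_left_approx:
  assumes "0 < s" "0 < e"
  shows "\<forall>\<^sub>F t in at_left s. F (d - 1) t < F (d - 1) s + e"
proof -
  have "\<forall>\<^sub>F t in at_left s. 0 < t" using assms by (auto simp: eventually_at_left_field)
  moreover have "\<forall>\<^sub>F t in at_left s. - left_deriv (F (d - 2)) t < - left_deriv (F (d - 2)) s + e"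
    by (intro left_deriv_left_approx F_top_facts assms)
  ultimately show ?thesis
    by eventually_elim (use assms in \<open>auto simp: F_top_eq_left_deriv simp del: One_nat_def\<close>)
qed

lemma F_measurable:
  assumes "k \<le> d - 1"
  shows "F k \<in> borel_measurable borel"
proof -
  have "mono_on {0<..} (\<lambda>s. - F k s)"
    using F_antimono[OF assms] by (auto simp: mono_on_def)
  then have "(\<lambda>s. - (- F k s)) \<in> borel_measurable (restrict_space borel {0<..})"
    by (intro borel_measurable_uminus borel_measurable_mono_on_fnc)
  then have "(\<lambda>s. if 0 < s then F k s else (if k = 0 then 1 else 0)) \<in> borel_measurable borel"
    by (subst measurable_If_restrict_space_iff) (auto simp: greaterThan_def)
  also have "(\<lambda>s. if 0 < s then F k s else (if k = 0 then 1 else 0)) = F k"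
    by (auto simp: fun_eq_iff wchain_def psiE_def)
  finally show ?thesis .
qed

end

subsection \<open>The conditional distribution functions\<close>

declare One_nat_def [simp del]

text \<open>Clipping keeps the argument in the unit interval, where \<open>psi_le_iff\<close> turns
  the preimages of upper rays into half-lines.\<close>

lemma (in generator) phi_clip_measurable:
  "(\<lambda>u. phi \<psi> (max 0 (min 1 u))) \<in> borel_measurable borel"
  unfolding borel_measurable_ereal_iff_Ioi
proof
  fix c :: ereal
  show "(\<lambda>u. phi \<psi> (max 0 (min 1 u))) -` {c<..} \<inter> space borel \<in> sets borel"
  proof (cases "0 \<le> c \<and> c < \<infinity>")
    case True
    then obtain z where z: "c = ereal z" "0 \<le> z" by (cases c) auto
    then have "(\<lambda>u. phi \<psi> (max 0 (min 1 u))) -` {c<..} \<inter> space borel = {u. \<not> \<psi> z \<le> max 0 (min 1 u)}"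
      using psi_le_iff[of z] by auto
    then show ?thesis by simp
  next
    case False
    then consider "c = \<infinity>" | "c < 0" by force
    then show ?thesis
    proof cases
      case 1
      then have "(\<lambda>u. phi \<psi> (max 0 (min 1 u))) -` {c<..} = {}" by auto
      then show ?thesis by simp
    next
      case 2
      then have "c < phi \<psi> v" for v using phi_nonneg[of v] by (auto intro: less_le_trans)
      then have "(\<lambda>u. phi \<psi> (max 0 (min 1 u))) -` {c<..} = UNIV" by auto
      then show ?thesis by simp
    qed
  qed
qed

lemma cube_nth: "x \<in> cube n \<Longrightarrow> i < n \<Longrightarrow> 0 \<le> x i \<and> x i \<le> 1"
  by (auto simp: cube_def PiE_iff)

lemma (in generator) Msum_nonneg: "0 \<le> Msum \<psi> n x"
  unfolding Msum_def by (intro sum_nonneg phi_nonneg)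

lemma (in generator) Msum_eq_0_iff:
  assumes x: "x \<in> cube n" and n: "0 < n"
  shows "Msum \<psi> n x = 0 \<longleftrightarrow> Min (x ` {..<n}) = 1"
proof -
  have "Msum \<psi> n x = 0 \<longleftrightarrow> (\<forall>i<n. phi \<psi> (x i) = 0)"
    unfolding Msum_def by (subst sum_nonneg_eq_0_iff) (auto intro: phi_nonneg)
  also have "\<dots> \<longleftrightarrow> (\<forall>i<n. x i = 1)" using phi_eq_0_iff cube_nth[OF x] by auto
  also have "\<dots> \<longleftrightarrow> Min (x ` {..<n}) = 1"
  proof
    assume "\<forall>i<n. x i = 1"
    then have "x ` {..<n} = {1}" using n by auto
    then show "Min (x ` {..<n}) = 1" by simp
  next
    assume "Min (x ` {..<n}) = 1"
    then have "1 \<le> x i" if "i < n" for i using Min_le[of "x ` {..<n}" "x i"] that by simp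
    then show "\<forall>i<n. x i = 1" using cube_nth[OF x] by (meson antisym)
  qed
  finally show ?thesis .
qed

context d_monotone_generator
begin

text \<open>\<open>real_of_ereal\<close> sends infinity to 0, where \<open>F (d - 1)\<close> is 0 by
  its default value. This yields the convention for the left derivative at infinity without a case
  split.\<close>

definition F_ext :: "ereal \<Rightarrow> real" where
  "F_ext z = F (d - 1) (real_of_ereal z)"

lemma F_top_0 [simp]: "s \<le> 0 \<Longrightarrow> F (d - 1) s = 0"
  using d3 by (simp add: wchain_def)

lemma F_ext_ereal [simp]: "F_ext (ereal r) = F (d - 1) r" and F_ext_infty [simp]: "F_ext \<infinity> = 0"
  using F_top_0[of 0] by (simp_all add: F_ext_def del: F_top_0)

lemma F_ext_nonneg: "0 \<le> F_ext z"
  using F_nonneg[of "d - 1" "real_of_ereal z"] F_top_0[of "real_of_ereal z"]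
  by (cases "real_of_ereal z \<le> 0") (auto simp: F_ext_def simp del: F_top_0)

lemma F_ext_antimono: "0 < a \<Longrightarrow> a \<le> b \<Longrightarrow> F_ext b \<le> F_ext a"
  using F_ext_nonneg[of a] F_antimono[of "d - 1"] by (cases a; cases b) auto

lemma F_ext_eq_0: "phi \<psi> 0 < z \<Longrightarrow> F_ext z = 0"
  using F_eq_0[of "d - 1"] by (cases z) auto

lemma F_ext_measurable [measurable]: "F_ext \<in> borel_measurable borel"
  unfolding F_ext_def[abs_def] using measurable_compose[OF borel_measurable_real_of_ereal[OF measurable_ident] F_measurable] by simp

lemma Dm_eq: "0 < z \<Longrightarrow> Dm d \<psi> z = (-1) ^ (d - 1) * F_ext z"
proof (cases z)
  case (real r)
  assume "0 < z"
  with real have r: "0 < r" by simp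
  have "d - 1 \<noteq> 0" "\<not> d - 1 \<le> d - 2" using d3 by auto
  then have "F (d - 1) r = (-1) ^ (d - 1) * left_deriv ((deriv ^^ (d - 2)) \<psi>) r"
    using r unfolding wchain_def by simp
  moreover have "(-1) ^ n * ((-1) ^ n * c) = (c :: real)" for n c
    by (simp add: mult.assoc[symmetric] power_mult_distrib[symmetric])
  ultimately show ?thesis using real by (simp add: Dm_def del: One_nat_def)
qed (auto simp: Dm_def)

text \<open>The case \<open>y < f\<^sup>0(x)\<close> of the kernel is absorbed by the quotient, whose numerator vanishes
  beyond \<open>\<phi>(0)\<close>.\<close>

lemma KC_eq:
  assumes x: "x \<in> cube (d - 1)" and y: "0 \<le> y" "y \<le> 1"
  shows "KC d \<psi> x y = (if Msum \<psi> (d - 1) x = 0 \<or> phi \<psi> 0 \<le> Msum \<psi> (d - 1) x then 1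
     else F_ext (Msum \<psi> (d - 1) x + phi \<psi> y) / F_ext (Msum \<psi> (d - 1) x))"
proof -
  define S where "S = Msum \<psi> (d - 1) x"
  have min: "Min (x ` {..<d - 1}) = 1 \<longleftrightarrow> S = 0"
    using Msum_eq_0_iff[OF x] d3 by (simp add: S_def)
  have L0: "in_L0 \<psi> (d - 1) x \<longleftrightarrow> phi \<psi> 0 \<le> S" by (simp add: in_L0_def S_def)
  show ?thesis
  proof (cases "S = 0 \<or> phi \<psi> 0 \<le> S")
    case True
    then show ?thesis unfolding KC_def min L0 S_def[symmetric] by simp
  next
    case False
    with Msum_nonneg[of "d - 1" x] have S: "0 < S" "S < phi \<psi> 0" by (auto simp: S_def less_le)
    then obtain s where s: "S = ereal s" "0 < s" by (cases S) auto
    have pos: "0 < S + phi \<psi> y" using S phi_nonneg[of y] by (simp add: add_pos_nonneg)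
    have "y < f0 \<psi> (d - 1) x \<longleftrightarrow> phi \<psi> 0 < S + phi \<psi> y"
      using psiE_phi0_minus[of s y] S s y False unfolding f0_def L0 S_def[symmetric] by simp
    moreover have "F_ext (S + phi \<psi> y) = 0" if "phi \<psi> 0 < S + phi \<psi> y" using F_ext_eq_0[OF that] .
    ultimately show ?thesis using False
      unfolding KC_def min L0 S_def[symmetric] Dm_eq[OF pos] Dm_eq[OF S(1)] by simp
  qed
qed

text \<open>A finite \<open>p\<close> uses left approximation at \<open>s + p\<close>; an infinite
  \<open>p\<close>, arising from \<open>y = 0\<close> when \<open>\<psi>\<close> never vanishes,
  uses decay at infinity.\<close>

lemma F_ext_left_approx:
  assumes s: "0 < s" and p: "0 < p" and e: "0 < e"
  shows "\<exists>z>0. ereal z < p \<and> F_ext (ereal (s + z)) < F_ext (ereal s + p) + e"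
proof (cases p)
  case (real r)
  with p have r: "0 < r" by simp
  have "\<forall>\<^sub>F t in at_left (s + r). F (d - 1) t < F (d - 1) (s + r) + e"
    using s r e by (intro F_top_left_approx) auto
  moreover have "\<forall>\<^sub>F t in at_left (s + r). s < t \<and> t < s + r"
    using r by (auto simp: eventually_at_left_field intro!: exI[of _ s])
  ultimately have "\<forall>\<^sub>F t in at_left (s + r). F (d - 1) t < F (d - 1) (s + r) + e \<and> s < t \<and> t < s + r"
    by (rule eventually_conj)
  then obtain t where "F (d - 1) t < F (d - 1) (s + r) + e" "s < t" "t < s + r"
    using eventually_happens'[OF trivial_limit_at_left_real] by blast
  then show ?thesis using real by (intro exI[of _ "t - s"]) auto
next
  case PInf
  have "\<forall>\<^sub>F t in at_top. F (d - 1) t < e" using F_lim[of "d - 1"] e by (simp add: order_tendstoD)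
  moreover have "\<forall>\<^sub>F t in at_top. s < t" by (rule eventually_gt_at_top)
  ultimately have "\<forall>\<^sub>F t in at_top. F (d - 1) t < e \<and> s < t" by (rule eventually_conj)
  then obtain t where "F (d - 1) t < e" "s < t" using eventually_happens'[OF trivial_limit_at_top_linorder] by blast
  then show ?thesis using PInf by (intro exI[of _ "t - s"]) auto
qed (use p in auto)

section \<open>Regularity of the conditional distribution functions in \<open>y\<close>\<close>

lemma KC_cases:
  assumes x: "x \<in> cube (d - 1)"
  obtains (one) "\<And>y. y \<in> {0..1} \<Longrightarrow> KC d \<psi> x y = 1"
  | (ratio) s where "0 < s" "0 < F (d - 1) s" 
      "\<And>y. y \<in> {0..1} \<Longrightarrow> KC d \<psi> x y = F_ext (ereal s + phi \<psi> y) / F (d - 1) s"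
proof (cases "Msum \<psi> (d - 1) x = 0 \<or> phi \<psi> 0 \<le> Msum \<psi> (d - 1) x")
  case True
  then show thesis using KC_eq[OF x] one by auto
next
  case False
  with Msum_nonneg[of "d - 1" x] obtain s where s: "Msum \<psi> (d - 1) x = ereal s" "0 < s" "ereal s < phi \<psi> 0"
    by (cases "Msum \<psi> (d - 1) x") auto
  with False show thesis using KC_eq[OF x] F_top_pos[of s] by (intro ratio[of s]) auto
qed

lemma KC_mono_on:
  assumes x: "x \<in> cube (d - 1)"
  shows "mono_on {0..1} (KC d \<psi> x)"
  using x
proof (cases rule: KC_cases)
  case (ratio s)
  show ?thesis
  proof (rule mono_onI)
    fix u v :: real assume uv: "u \<in> {0..1}" "v \<in> {0..1}" "u \<le> v"
    have "0 < ereal s + phi \<psi> v" using ratio phi_nonneg[of v] by (simp add: add_pos_nonneg)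
    then have "F_ext (ereal s + phi \<psi> u) \<le> F_ext (ereal s + phi \<psi> v)"
      using uv by (intro F_ext_antimono add_left_mono phi_antimono) auto
    then show "KC d \<psi> x u \<le> KC d \<psi> x v" using ratio uv by (simp add: divide_right_mono)
  qed
qed (auto simp: mono_on_def)

lemma KC_1:
  assumes x: "x \<in> cube (d - 1)"
  shows "KC d \<psi> x 1 = 1"
  using x by (cases rule: KC_cases) auto

lemma KC_nonneg:
  assumes x: "x \<in> cube (d - 1)" and y: "y \<in> {0..1}"
  shows "0 \<le> KC d \<psi> x y"
  using x by (cases rule: KC_cases) (use y F_ext_nonneg in auto)

lemma KC_right_tendsto:
  assumes x: "x \<in> cube (d - 1)" and y: "y \<in> {0..<1}"
  shows "(KC d \<psi> x \<longlongrightarrow> KC d \<psi> x y) (at_right y)"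
  using x
proof (cases rule: KC_cases)
  case one
  have "\<forall>\<^sub>F v in at_right y. 1 = KC d \<psi> x v"
    using y one by (auto simp: eventually_at_right_field intro!: exI[of _ 1])
  then show ?thesis using one[of y] y by (auto intro: Lim_transform_eventually[OF tendsto_const])
next
  case (ratio s)
  show ?thesis
  proof (rule order_tendstoI)
    fix a assume "a < KC d \<psi> x y"
    then show "\<forall>\<^sub>F v in at_right y. a < KC d \<psi> x v"
      using y mono_onD[OF KC_mono_on[OF x], of y]
      by (auto simp: eventually_at_right_field intro!: exI[of _ 1] intro: less_le_trans)
  next
    fix a assume a: "KC d \<psi> x y < a"
    \<comment> \<open>The gap up to \<open>a\<close>, rescaled by the denominator so that it can be
      spent on the numerator.\<close>
    define e where "e = (a - KC d \<psi> x y) * F (d - 1) s"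
    have e: "0 < e" using a ratio by (simp add: e_def)
    have "0 < phi \<psi> y" using phi_eq_0_iff[of y] phi_nonneg[of y] y by (auto simp: less_le)
    from F_ext_left_approx[OF ratio(1) this e] obtain z where
      z: "0 < z" "ereal z < phi \<psi> y" "F_ext (ereal (s + z)) < F_ext (ereal s + phi \<psi> y) + e" by blast
    \<comment> \<open>\<open>v < \<psi> z\<close> keeps \<open>phi \<psi> v\<close> above
      \<open>z\<close>, and \<open>z < phi \<psi> y\<close> makes this window to the right of
      \<open>y\<close> non-empty.\<close>
    have "KC d \<psi> x v < a" if v: "y < v" "v < min 1 (\<psi> z)" for v
    proof -
      have "ereal z \<le> phi \<psi> v" using psi_le_iff[of z v] v y z by auto
      then have "F_ext (ereal s + phi \<psi> v) \<le> F_ext (ereal s + ereal z)"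
        using ratio z by (intro F_ext_antimono add_left_mono) auto
      also have "\<dots> < F_ext (ereal s + phi \<psi> y) + e" using z by simp
      finally have "F_ext (ereal s + phi \<psi> v) / F (d - 1) s < (F_ext (ereal s + phi \<psi> y) + e) / F (d - 1) s"
        using ratio by (simp add: divide_strict_right_mono)
      also have "\<dots> = a" using ratio y by (simp add: add_divide_distrib e_def)
      finally show ?thesis using ratio(3)[of v] v y by simp
    qed
    moreover have "y < min 1 (\<psi> z)" using psi_le_iff[of z y] z y by (auto simp: not_le[symmetric])
    ultimately show "\<forall>\<^sub>F v in at_right y. KC d \<psi> x v < a"
      by (auto simp: eventually_at_right_field intro!: exI[of _ "min 1 (\<psi> z)"])
  qed
qed

lemma KC_measure_facts:
  assumes x: "x \<in> cube (d - 1)"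
  shows prob_space_KC_measure: "prob_space (KC_measure d \<psi> x)"
    and emeasure_KC_measure_atMost: "emeasure (KC_measure d \<psi> x) {..y} = ennreal (if y < 0 then 0 else KC d \<psi> x (min y 1))"
proof -
  \<comment> \<open>\<open>G\<close> may jump at 0: where the kernel is constantly 1, the induced
    measure is the point mass at 0.\<close>
  define G where "G y = (if y < 0 then 0 else KC d \<psi> x (min y 1))" for y
  have mono: "G u \<le> G v" if "u \<le> v" for u v
    using mono_onD[OF KC_mono_on[OF x], of "min u 1" "min v 1"] KC_nonneg[OF x, of "min v 1"] that
    by (auto simp: G_def)
  have right: "continuous (at_right a) G" for a
  proof -
    consider "a < 0" | "0 \<le> a" "a < 1" | "1 \<le> a" by linarith
    then have "(G \<longlongrightarrow> G a) (at_right a)"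
    proof cases
      case 1
      then have "\<forall>\<^sub>F v in at_right a. G a = G v" by (auto simp: eventually_at_right_field G_def intro!: exI[of _ 0])
      then show ?thesis by (auto intro: Lim_transform_eventually[OF tendsto_const])
    next
      case 2
      then have "\<forall>\<^sub>F v in at_right a. KC d \<psi> x v = G v" by (auto simp: eventually_at_right_field G_def intro!: exI[of _ 1])
      with KC_right_tendsto[OF x, of a] 2 show ?thesis
        by (auto simp: G_def[of a] intro: Lim_transform_eventually)
    next
      case 3
      then have "\<forall>\<^sub>F v in at_right a. G a = G v" by (auto simp: eventually_at_right_field G_def intro!: exI[of _ "a + 1"])
      then show ?thesis by (auto intro: Lim_transform_eventually[OF tendsto_const])
    qed
    then show ?thesis by (simp add: continuous_within)
  qed
  have bot: "(G \<longlongrightarrow> 0) at_bot"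
    by (rule tendsto_eventually) (auto simp: eventually_at_bot_linorder G_def intro!: exI[of _ "-1"])
  have top: "(G \<longlongrightarrow> 1) at_top"
    by (rule tendsto_eventually) (auto simp: eventually_at_top_linorder G_def KC_1[OF x] intro!: exI[of _ 1])
  have K: "KC_measure d \<psi> x = interval_measure G" unfolding KC_measure_def G_def ..
  show "prob_space (KC_measure d \<psi> x)"
    using real_distribution_interval_measure[OF mono right bot top] unfolding K real_distribution_def by blast
  show "emeasure (KC_measure d \<psi> x) {..y} = ennreal (if y < 0 then 0 else KC d \<psi> x (min y 1))"
    unfolding K using emeasure_interval_measure_Iic[OF mono right bot, of y] by (simp add: G_def)
qed

lemma sets_KC_measure [simp]: "sets (KC_measure d \<psi> x) = sets borel"
  and space_KC_measure [simp]: "space (KC_measure d \<psi> x) = UNIV"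
  by (simp_all add: KC_measure_def)

lemma emeasure_KC_measure_unit:
  assumes x: "x \<in> cube (d - 1)"
  shows "emeasure (KC_measure d \<psi> x) {0..1} = 1"
proof -
  interpret prob_space "KC_measure d \<psi> x" by (rule prob_space_KC_measure[OF x])
  have *: "emeasure (KC_measure d \<psi> x) {..1} = 1" using emeasure_KC_measure_atMost[OF x, of 1] KC_1[OF x] by simp
  have "emeasure (KC_measure d \<psi> x) {..<0} = 0"
  proof -
    \<comment> \<open>The distribution function gives the mass of closed rays only, so the open ray
      is exhausted by closed null ones.\<close>
    have "{..<0 :: real} = (\<Union>n. {.. - 1 / real (Suc n)})"
    proof (intro set_eqI iffI)
      fix w :: real assume "w \<in> {..<0}"
      then have "0 < - w" by simp
      then obtain n where "1 / real (Suc n) < - w" by (rule nat_approx_posE)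
      then show "w \<in> (\<Union>n. {.. - 1 / real (Suc n)})" by (intro UN_I[of n]) auto
    qed (auto intro: le_less_trans)
    moreover have "emeasure (KC_measure d \<psi> x) (\<Union>n. {.. - 1 / real (Suc n)}) = 0"
      by (rule emeasure_UN_eq_0) (auto simp: emeasure_KC_measure_atMost[OF x])
    ultimately show ?thesis by simp
  qed
  then have "emeasure (KC_measure d \<psi> x) ({..1} - {..<0}) = 1"
    using emeasure_Diff_null_set[of "{..<0}" "KC_measure d \<psi> x" "{..1}"] * by (simp add: null_sets_def)
  moreover have "{..1} - {..<0} = {0..1::real}" by auto
  ultimately show ?thesis by simp
qed

section \<open>Measurability of the kernel in \<open>x\<close>\<close>

abbreviation cube_space :: "(nat \<Rightarrow> real) measure" where
  "cube_space \<equiv> restrict_space (PiM {..<d - 1} (\<lambda>_. borel)) (cube (d - 1))"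

lemma space_cube_space [simp]: "space cube_space = cube (d - 1)"
  by (auto simp: space_restrict_space space_PiM cube_def)

lemma Msum_measurable: "Msum \<psi> (d - 1) \<in> borel_measurable cube_space"
proof -
  have "(\<lambda>x. \<Sum>i<d - 1. phi \<psi> (max 0 (min 1 (x i)))) \<in> borel_measurable (PiM {..<d - 1} (\<lambda>_. borel))"
    by (intro borel_measurable_ereal_sum measurable_compose[OF _ phi_clip_measurable] measurable_component_singleton) auto
  then have "(\<lambda>x. \<Sum>i<d - 1. phi \<psi> (max 0 (min 1 (x i)))) \<in> borel_measurable cube_space"
    by (rule measurable_restrict_space1)
  then show ?thesis
  proof (subst (asm) measurable_cong)
    fix x assume "x \<in> space cube_space"
    then have "max 0 (min 1 (x i)) = x i" if "i < d - 1" for i using cube_nth[of x "d - 1" i] that by simp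
    then show "(\<Sum>i<d - 1. phi \<psi> (max 0 (min 1 (x i)))) = Msum \<psi> (d - 1) x" by (simp add: Msum_def)
  qed
qed

lemma KC_measurable:
  assumes "y \<in> {0..1}"
  shows "(\<lambda>x. KC d \<psi> x y) \<in> borel_measurable cube_space"
proof -
  note Msum_measurable [measurable]
  have "(\<lambda>x. if Msum \<psi> (d - 1) x = 0 \<or> phi \<psi> 0 \<le> Msum \<psi> (d - 1) x then 1
     else F_ext (Msum \<psi> (d - 1) x + phi \<psi> y) / F_ext (Msum \<psi> (d - 1) x)) \<in> borel_measurable cube_space"
    by measurable
  then show ?thesis
    by (rule measurable_cong[THEN iffD1, rotated]) (use KC_eq assms in auto)
qed

lemma KC_measure_measurable:
  "KC_measure d \<psi> \<in> measurable cube_space (prob_algebra borel)"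
proof (rule measurable_prob_algebra_generated)
  show "sets borel = sigma_sets UNIV (range (\<lambda>a::real. {..a}))" by (simp add: borel_eq_atMost)
  show "Int_stable (range (\<lambda>a::real. {..a}))" by (auto simp: Int_stable_def)
  fix A assume "A \<in> range (\<lambda>a::real. {..a})"
  then obtain y where A: "A = {..y}" by auto
  have "(\<lambda>x. ennreal (if y < 0 then 0 else KC d \<psi> x (min y 1))) \<in> borel_measurable cube_space"
    using KC_measurable[of "min y 1"] by (cases "y < 0") auto
  then show "(\<lambda>x. emeasure (KC_measure d \<psi> x) A) \<in> borel_measurable cube_space"
    unfolding A by (rule measurable_cong[THEN iffD1, rotated]) (use emeasure_KC_measure_atMost in auto)
qed (auto intro: prob_space_KC_measure)

end

subsection \<open>Distributions on the unit cube and iterated tail integrals\<close>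

lemma PiM_borel_eq_sigma_atMost:
  fixes n :: nat
  shows "sets (PiM {..<n} (\<lambda>_. borel :: real measure)) =
     sigma_sets (PiE {..<n} (\<lambda>_. UNIV)) (range (\<lambda>u. {v \<in> PiE {..<n} (\<lambda>_. UNIV). \<forall>i<n. v i \<le> u i}))"
proof -
  \<comment> \<open>The only index block is \<open>{..<n}\<close> itself, so the generators
    constrain all coordinates at once and are exactly the lower boxes.\<close>
  let ?P = "{{f\<in>(\<Pi>\<^sub>E i\<in>{..<n}. UNIV). \<forall>i\<in>j. f i \<in> A i} | A j. j \<in> {{..<n}} \<and> A \<in> Pi j (\<lambda>_. range (\<lambda>a::real. {..a}))}"
  let ?R = "range (\<lambda>u::nat \<Rightarrow> real. {v \<in> PiE {..<n} (\<lambda>_. UNIV). \<forall>i<n. v i \<le> u i})"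
  have "sets (PiM {..<n} (\<lambda>_. sigma UNIV (range (\<lambda>a::real. {..a})))) = sets (sigma (PiE {..<n} (\<lambda>_. UNIV)) ?P)"
  proof (rule sets_PiM_sigma)
    fix i
    have "(UNIV :: real set) = (\<Union>k::nat. {..real k})" using real_arch_simple by blast
    then show "\<exists>S\<subseteq>range (\<lambda>a::real. {..a}). countable S \<and> UNIV = \<Union>S"
      by (intro exI[of _ "range (\<lambda>k::nat. {..real k})"]) auto
  qed auto
  also have "\<dots> = sigma_sets (PiE {..<n} (\<lambda>_. UNIV)) ?P" by (rule sets_measure_of) auto
  also have "?P = ?R"
  proof (intro set_eqI iffI)
    fix X assume "X \<in> ?P"
    then obtain A where A: "X = {f\<in>(\<Pi>\<^sub>E i\<in>{..<n}. UNIV). \<forall>i\<in>{..<n}. f i \<in> A i}"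
      "A \<in> Pi {..<n} (\<lambda>_. range (\<lambda>a::real. {..a}))" by blast
    from A(2) have "\<forall>i<n. \<exists>a. A i = {..a}" by auto
    then obtain u where "\<forall>i<n. A i = {..u i}" by metis
    with A(1) show "X \<in> ?R" by (intro image_eqI[of _ _ u]) auto
  next
    fix X assume "X \<in> ?R"
    then obtain u where "X = {v \<in> PiE {..<n} (\<lambda>_. UNIV). \<forall>i<n. v i \<le> u i}" by auto
    then show "X \<in> ?P"
      by (intro CollectI exI[of _ "\<lambda>i. {..u i}"] exI[of _ "{..<n}"]) auto
  qed
  finally show ?thesis by (simp only: borel_eq_atMost[symmetric])
qed

text \<open>Both hypotheses concern corners in the cube. Bounding the other coordinates by 1 in
  \<open>zero\<close> costs nothing, since the box with corner 1 has full mass.\<close>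

lemma AE_unit_box:
  fixes n :: nat
  assumes M: "prob_space M" "sets M = sets (PiM {..<n} (\<lambda>_. borel :: real measure))"
    and one: "emeasure M {v \<in> space M. \<forall>i<n. v i \<le> 1} = 1"
    and zero: "\<And>j. j < n \<Longrightarrow> emeasure M {v \<in> space M. \<forall>i<n. v i \<le> (if i = j then 0 else 1)} = 0"
  shows "AE v in M. \<forall>i<n. 0 < v i \<and> v i \<le> 1"
proof -
  interpret prob_space M by (rule M)
  have box: "{v \<in> space M. \<forall>i<n. v i \<le> u i} \<in> sets M" for u
    unfolding M(2) sets_eq_imp_space_eq[OF M(2)] PiM_borel_eq_sigma_atMost
    by (rule sigma_sets.Basic) (simp add: space_PiM)
  have "AE v in M. v \<in> {v \<in> space M. \<forall>i<n. v i \<le> 1}"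
    by (rule AE_prob_1, unfold measure_def one) simp
  moreover have "AE v in M. \<forall>j\<in>{..<n}. \<not> (\<forall>i<n. v i \<le> (if i = j then 0 else 1))"
  proof (rule AE_finite_allI)
    fix j assume "j \<in> {..<n}"
    then have j: "j < n" by simp
    show "AE v in M. \<not> (\<forall>i<n. v i \<le> (if i = j then 0 else 1))"
      by (rule AE_I[OF _ zero[OF j] box]) blast
  qed simp
  ultimately show ?thesis
  proof eventually_elim
    case (elim v)
    show ?case
    proof (intro allI impI conjI)
      fix i assume i: "i < n"
      with elim show "v i \<le> 1" by blast
      show "0 < v i"
      proof (rule ccontr)
        assume "\<not> 0 < v i"
        then have "\<forall>k<n. v k \<le> (if k = i then 0 else 1)" using elim by simp
        with elim i show False by blast
      qed
    qed
  qed
qed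

text \<open>Lower boxes form an intersection-stable generator, but agreement is given for corners in
  the cube only. With almost all mass in the cube, a negative corner coordinate gives a null box and
  coordinates above 1 may be cut to 1.\<close>

lemma measure_eqI_cdf_unit_box:
  fixes n :: nat
  assumes M: "prob_space M" "sets M = sets (PiM {..<n} (\<lambda>_. borel :: real measure))"
    and N: "prob_space N" "sets N = sets (PiM {..<n} (\<lambda>_. borel :: real measure))"
    and eq: "\<And>u. u \<in> cube n \<Longrightarrow> emeasure M {v \<in> space M. \<forall>i<n. v i \<le> u i} = emeasure N {v \<in> space N. \<forall>i<n. v i \<le> u i}"
    and one: "emeasure M {v \<in> space M. \<forall>i<n. v i \<le> 1} = 1"
    and zero: "\<And>j. j < n \<Longrightarrow> emeasure M {v \<in> space M. \<forall>i<n. v i \<le> (if i = j then 0 else 1)} = 0"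
  shows "M = N"
proof -
  have spM: "space M = PiE {..<n} (\<lambda>_. UNIV)" and spN: "space N = PiE {..<n} (\<lambda>_. UNIV)"
    using sets_eq_imp_space_eq[OF M(2)] sets_eq_imp_space_eq[OF N(2)] by (simp_all add: space_PiM)
  have box: "{v \<in> PiE {..<n} (\<lambda>_. UNIV). \<forall>i<n. v i \<le> u i} \<in> sets (PiM {..<n} (\<lambda>_. borel :: real measure))" for u :: "nat \<Rightarrow> real"
    unfolding PiM_borel_eq_sigma_atMost by (rule sigma_sets.Basic) auto
  have eq': "emeasure M {v \<in> space M. \<forall>i<n. v i \<le> u i} = emeasure N {v \<in> space N. \<forall>i<n. v i \<le> u i}" if "\<And>i. i < n \<Longrightarrow> u i \<in> {0..1}" for u
    \<comment> \<open>\<open>cube n\<close> consists of extensional functions, so the corner is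
      restricted first.\<close>
    using eq[of "restrict u {..<n}"] that by (simp add: cube_def)
  have AM: "AE v in M. \<forall>i<n. 0 < v i \<and> v i \<le> 1"
    by (rule AE_unit_box[OF M one zero])
  have AN: "AE v in N. \<forall>i<n. 0 < v i \<and> v i \<le> 1"
  proof (rule AE_unit_box[OF N])
    show "emeasure N {v \<in> space N. \<forall>i<n. v i \<le> 1} = 1"
      using eq'[of "\<lambda>_. 1"] one by simp
    show "emeasure N {v \<in> space N. \<forall>i<n. v i \<le> (if i = j then 0 else 1)} = 0" if "j < n" for j
      using eq'[of "\<lambda>i. if i = j then 0 else 1"] zero[OF that] by simp
  qed
  have all: "emeasure M {v \<in> space M. \<forall>i<n. v i \<le> u i} = emeasure N {v \<in> space N. \<forall>i<n. v i \<le> u i}" for u :: "nat \<Rightarrow> real"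
  proof (cases "\<exists>j<n. u j < 0")
    case True
    then obtain j where j: "j < n" "u j < 0" by blast
    have "emeasure P {v \<in> space P. \<forall>i<n. v i \<le> u i} = 0" if "AE v in P. \<forall>i<n. 0 < v i \<and> v i \<le> 1" for P
    proof (rule emeasure_eq_0_AE)
      from that show "AE v in P. \<not> (\<forall>i<n. v i \<le> u i)"
      proof eventually_elim
        case (elim v)
        with j(1) have "0 < v j" by blast
        with j show ?case by (metis less_le_trans not_less_iff_gr_or_eq)
      qed
    qed
    from this[OF AM] this[OF AN] show ?thesis by simp
  next
    case False
    have cut: "emeasure P {v \<in> space P. \<forall>i<n. v i \<le> u i} = emeasure P {v \<in> space P. \<forall>i<n. v i \<le> min (u i) 1}"
      if P: "space P = PiE {..<n} (\<lambda>_. UNIV)" "sets P = sets (PiM {..<n} (\<lambda>_. borel))"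
        and "AE v in P. \<forall>i<n. 0 < v i \<and> v i \<le> 1" for P
    proof (rule emeasure_eq_AE)
      from that(3) show "AE v in P. v \<in> {v \<in> space P. \<forall>i<n. v i \<le> u i} \<longleftrightarrow> v \<in> {v \<in> space P. \<forall>i<n. v i \<le> min (u i) 1}"
        by eventually_elim simp
    qed (use box[of u] box[of "\<lambda>i. min (u i) 1"] in \<open>simp_all only: P\<close>)
    have "emeasure M {v \<in> space M. \<forall>i<n. v i \<le> min (u i) 1} = emeasure N {v \<in> space N. \<forall>i<n. v i \<le> min (u i) 1}"
      by (rule eq') (use False in \<open>auto intro: leI\<close>)
    with cut[OF spM M(2) AM] cut[OF spN N(2) AN] show ?thesis by simp
  qed
  show ?thesis
  proof (rule measure_eqI_generator_eq)
    let ?R = "\<lambda>u::nat \<Rightarrow> real. {v \<in> PiE {..<n} (\<lambda>_. UNIV). \<forall>i<n. v i \<le> u i}"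
    show "Int_stable (range ?R)"
    proof (rule Int_stableI)
      fix a b assume "a \<in> range ?R" "b \<in> range ?R"
      then obtain u w where "a = ?R u" "b = ?R w" by auto
      then have "a \<inter> b = ?R (\<lambda>i. min (u i) (w i))" by auto
      then show "a \<inter> b \<in> range ?R" by (intro image_eqI[where x = "\<lambda>i. min (u i) (w i)"]) simp_all
    qed
    show "sets M = sigma_sets (PiE {..<n} (\<lambda>_. UNIV)) (range ?R)" "sets N = sigma_sets (PiE {..<n} (\<lambda>_. UNIV)) (range ?R)"
      using M(2) N(2) by (simp_all only: PiM_borel_eq_sigma_atMost)
    show "range (\<lambda>k::nat. ?R (\<lambda>_. real k)) \<subseteq> range ?R" by auto
    show "(\<Union>k::nat. ?R (\<lambda>_. real k)) = PiE {..<n} (\<lambda>_. UNIV)"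
    proof (intro equalityI subsetI)
      fix v :: "nat \<Rightarrow> real" assume v: "v \<in> PiE {..<n} (\<lambda>_. UNIV)"
      obtain k :: nat where k: "(\<Sum>i<n. \<bar>v i\<bar>) \<le> real k" using real_arch_simple by blast
      have "v i \<le> real k" if "i < n" for i
        using member_le_sum[of i "{..<n}" "\<lambda>i. \<bar>v i\<bar>"] that k by auto
      with v show "v \<in> (\<Union>k::nat. ?R (\<lambda>_. real k))" by blast
    qed auto
    show "emeasure M (?R (\<lambda>_. real k)) \<noteq> \<infinity>" for k :: nat
      using finite_measure.emeasure_finite[OF prob_space.finite_measure[OF M(1)]] by simp
  qed (use all spM spN in auto)
qed

lemma nn_integral_iterated_tails:
  fixes g :: "nat \<Rightarrow> real \<Rightarrow> ennreal"
  assumes meas: "\<And>k. k \<le> m \<Longrightarrow> g k \<in> borel_measurable borel"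
    and step: "\<And>k a t. k < m \<Longrightarrow> 0 \<le> a \<Longrightarrow> (0 < k \<Longrightarrow> 0 < a) \<Longrightarrow> 0 \<le> t \<Longrightarrow>
      (\<integral>\<^sup>+z. g (Suc k) (a + z) * indicator {w. 0 < w \<and> t \<le> w} z \<partial>lborel) = g k (a + t)"
  shows "k \<le> m \<Longrightarrow> 0 \<le> s \<Longrightarrow> (\<And>i. i < k \<Longrightarrow> 0 \<le> t i) \<Longrightarrow>
    (\<integral>\<^sup>+z. g k (s + (\<Sum>i<k. z i)) * (\<Prod>i<k. indicator {w. 0 < w \<and> t i \<le> w} (z i)) \<partial>PiM {..<k} (\<lambda>_. lborel)) = g 0 (s + (\<Sum>i<k. t i))"
proof (induction k arbitrary: s)
  case 0
  interpret product_sigma_finite "\<lambda>_::nat. lborel :: real measure" ..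
  show ?case by (simp only: lessThan_0, subst nn_integral_empty) simp_all
next
  case (Suc k)
  interpret product_sigma_finite "\<lambda>_::nat. lborel :: real measure" ..
  let ?I = "\<lambda>i. indicator {w. 0 < w \<and> t i \<le> w} :: real \<Rightarrow> ennreal"
  note [measurable] = meas[OF Suc.prems(1)] meas[OF Suc_leD[OF Suc.prems(1)]]
  have "(\<integral>\<^sup>+z. g (Suc k) (s + (\<Sum>i<Suc k. z i)) * (\<Prod>i<Suc k. ?I i (z i)) \<partial>PiM {..<Suc k} (\<lambda>_. lborel))
    = (\<integral>\<^sup>+x. \<integral>\<^sup>+y. g (Suc k) (s + (\<Sum>i<Suc k. (x(k := y)) i)) * (\<Prod>i<Suc k. ?I i ((x(k := y)) i)) \<partial>lborel \<partial>PiM {..<k} (\<lambda>_. lborel))"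
    unfolding lessThan_Suc by (rule product_nn_integral_insert) (auto simp flip: lessThan_Suc)
  also have "\<dots> = (\<integral>\<^sup>+x. g k ((s + t k) + (\<Sum>i<k. x i)) * (\<Prod>i<k. ?I i (x i)) \<partial>PiM {..<k} (\<lambda>_. lborel))"
  proof (rule nn_integral_cong)
    fix x :: "nat \<Rightarrow> real"
    have "(\<integral>\<^sup>+y. g (Suc k) (s + (\<Sum>i<Suc k. (x(k := y)) i)) * (\<Prod>i<Suc k. ?I i ((x(k := y)) i)) \<partial>lborel)
      = (\<integral>\<^sup>+y. (\<Prod>i<k. ?I i (x i)) * (g (Suc k) ((s + (\<Sum>i<k. x i)) + y) * ?I k y) \<partial>lborel)"
      by (intro nn_integral_cong) (simp add: ac_simps)
    also have "\<dots> = (\<Prod>i<k. ?I i (x i)) * (\<integral>\<^sup>+y. g (Suc k) ((s + (\<Sum>i<k. x i)) + y) * ?I k y \<partial>lborel)"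
      by (rule nn_integral_cmult) measurable
    also have "\<dots> = (\<Prod>i<k. ?I i (x i)) * g k ((s + (\<Sum>i<k. x i)) + t k)"
    proof (cases "\<forall>i<k. 0 < x i")
      case True
      \<comment> \<open>The remaining coordinates make the shift positive as soon as there is one;
        if some coordinate is not positive, its indicator makes both sides 0.\<close>
      then have "0 \<le> (\<Sum>i<k. x i)" "0 < k \<Longrightarrow> 0 < (\<Sum>i<k. x i)"
        by (auto intro!: sum_nonneg sum_pos simp: less_imp_le)
      then show ?thesis using Suc.prems by (subst step) auto
    next
      case False
      then obtain i where "i < k" "\<not> 0 < x i" by blast
      then have "(\<Prod>i<k. ?I i (x i)) = 0" by (intro prod_zero bexI[of _ i]) auto
      then show ?thesis by (simp only: mult_zero_left)
    qed
    finally show "(\<integral>\<^sup>+y. g (Suc k) (s + (\<Sum>i<Suc k. (x(k := y)) i)) * (\<Prod>i<Suc k. ?I i ((x(k := y)) i)) \<partial>lborel)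
      = g k ((s + t k) + (\<Sum>i<k. x i)) * (\<Prod>i<k. ?I i (x i))" by (simp add: ac_simps)
  qed
  also have "\<dots> = g 0 ((s + t k) + (\<Sum>i<k. t i))"
    using Suc.prems by (intro Suc.IH) auto
  finally show ?case by (simp add: ac_simps)
qed

context d_monotone_generator
begin

lemma nn_integral_F_tail:
  assumes k: "k < d - 1" and a: "0 \<le> a" "0 < k \<Longrightarrow> 0 < a" and t: "0 \<le> t"
  shows "(\<integral>\<^sup>+z. ennreal (F (Suc k) (a + z)) * indicator {w. 0 < w \<and> t \<le> w} z \<partial>lborel) = ennreal (F k (a + t))"
proof -
  have [measurable]: "F (Suc k) \<in> borel_measurable borel" using k by (intro F_measurable) simp
  have "(\<integral>\<^sup>+z. ennreal (F (Suc k) (a + z)) * indicator {w. 0 < w \<and> t \<le> w} z \<partial>lborel)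
      = (\<integral>\<^sup>+z. ennreal (F (Suc k) (a + 1 * z)) * indicator {a + t<..} (a + 1 * z) \<partial>lborel)"
  proof (rule nn_integral_cong_AE)
    show "AE z in lborel. ennreal (F (Suc k) (a + z)) * indicator {w. 0 < w \<and> t \<le> w} z
        = ennreal (F (Suc k) (a + 1 * z)) * indicator {a + t<..} (a + 1 * z)"
      using AE_lborel_singleton[of t] by eventually_elim (use t in \<open>auto simp: indicator_def\<close>)
  qed
  also have "\<dots> = (\<integral>\<^sup>+w. ennreal (F (Suc k) w) * indicator {a + t<..} w \<partial>lborel)"
    using nn_integral_real_affine[of "\<lambda>w. ennreal (F (Suc k) w) * indicator {a + t<..} w" 1 a] by simp
  also have "\<dots> = ennreal (F k (a + t))"
  proof (rule neg_slope_between_nn_integral[OF F_slope[OF k]])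
    show "0 \<le> a + t" using a t by simp
    show "(F k \<longlongrightarrow> 0) at_top" using k by (intro F_lim) simp
    show "(F k \<longlongrightarrow> F k (a + t)) (at_right (a + t))"
    proof (cases "a + t = 0")
      \<comment> \<open>Only \<open>k = 0\<close> can occur here, where right continuity of
        \<open>\<psi>\<close> at 0 takes over from the slope bounds.\<close>
      case True
      with a t have "a = 0" by simp
      with a have "k = 0" by auto
      moreover have "\<forall>\<^sub>F s in at_right 0. \<psi> s = F 0 s" by (auto simp: eventually_at_right_field intro!: exI[of _ 1])
      with psi_right_cont[of 0] have "(F 0 \<longlongrightarrow> F 0 0) (at_right 0)"
        by (auto intro: Lim_transform_eventually)
      ultimately show ?thesis using True by simp
    next
      case False
      with a t have "0 < a + t" by simp
      with neg_slope_between_isCont[OF F_slope[OF k]] show ?thesis by (simp add: isCont_def filterlim_at_split)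
    qed
  qed measurable
  finally show ?thesis .
qed

text \<open>On the hyperplane \<open>\<Sum>z = \<phi>(0)\<close> the kernel is 1 while \<open>F\<^sub>d\<^sub>-\<^sub>1\<close> may be positive (the left
  derivative can jump there). Setting the density to 0 on this null set makes
  \<open>KC_times_density\<close> hold pointwise.\<close>

definition F_cut :: "real \<Rightarrow> real" where
  "F_cut s = (if ereal s < phi \<psi> 0 then F (d - 1) s else 0)"

lemma F_cut_measurable [measurable]: "F_cut \<in> borel_measurable borel"
  unfolding F_cut_def[abs_def] using F_measurable[of "d - 1"] by measurable

lemma F_cut_nonneg: "0 \<le> F_cut s"
  using F_ext_nonneg[of "ereal s"] by (simp add: F_cut_def)

text \<open>Below \<open>phi \<psi> 0\<close> the two agree by definition and above it both vanish,
  which leaves a single point.\<close>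

lemma AE_F_cut: "AE z in lborel. F_cut (a + z) = F (d - 1) (a + z)"
proof (cases "phi \<psi> 0")
  case (real r)
  have "AE z in lborel. z \<noteq> r - a" by (rule AE_lborel_singleton)
  then show ?thesis
    by eventually_elim (use real F_eq_0[of "d - 1"] in \<open>auto simp: F_cut_def not_less le_less\<close>)
qed (use phi_0_pos in \<open>auto simp: F_cut_def\<close>)

text \<open>Both top integrands are needed: \<open>F_cut\<close> for the margin,
  \<open>F (d - 1)\<close> for the shifted numerator of the kernel. The choice affects only the
  first integration, where they agree almost everywhere.\<close>

lemma nn_integral_F_orthant:
  assumes g: "g = F (d - 1) \<or> g = F_cut" and s: "0 \<le> s" and t: "\<And>i. i < d - 1 \<Longrightarrow> 0 \<le> t i"
  shows "(\<integral>\<^sup>+z. ennreal (g (s + (\<Sum>i<d - 1. z i))) * (\<Prod>i<d - 1. indicator {w. 0 < w \<and> t i \<le> w} (z i)) \<partial>PiM {..<d - 1} (\<lambda>_. lborel))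
    = ennreal (psiE \<psi> (ereal (s + (\<Sum>i<d - 1. t i))))"
proof -
  define G where "G k w = ennreal (if k = d - 1 then g w else F k w)" for k w
  have "d - 1 \<noteq> 0" using d3 by simp
  have "(\<integral>\<^sup>+z. G (d - 1) (s + (\<Sum>i<d - 1. z i)) * (\<Prod>i<d - 1. indicator {w. 0 < w \<and> t i \<le> w} (z i)) \<partial>PiM {..<d - 1} (\<lambda>_. lborel))
    = G 0 (s + (\<Sum>i<d - 1. t i))"
  proof (rule nn_integral_iterated_tails[where m = "d - 1"])
    show "G k \<in> borel_measurable borel" if "k \<le> d - 1" for k
      unfolding G_def using g F_measurable[OF that] F_measurable[of "d - 1"] by auto
    fix k and a t :: real assume k: "k < d - 1" and a: "0 \<le> a" "0 < k \<Longrightarrow> 0 < a" and t: "0 \<le> t"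
    have "(\<integral>\<^sup>+z. G (Suc k) (a + z) * indicator {w. 0 < w \<and> t \<le> w} z \<partial>lborel)
      = (\<integral>\<^sup>+z. ennreal (F (Suc k) (a + z)) * indicator {w. 0 < w \<and> t \<le> w} z \<partial>lborel)"
    proof (rule nn_integral_cong_AE)
      show "AE z in lborel. G (Suc k) (a + z) * indicator {w. 0 < w \<and> t \<le> w} z
          = ennreal (F (Suc k) (a + z)) * indicator {w. 0 < w \<and> t \<le> w} z"
        using AE_F_cut[of a] by eventually_elim (use g in \<open>auto simp: G_def\<close>)
    qed
    also have "\<dots> = G k (a + t)" using nn_integral_F_tail[OF k a t] k by (simp add: G_def)
    finally show "(\<integral>\<^sup>+z. G (Suc k) (a + z) * indicator {w. 0 < w \<and> t \<le> w} z \<partial>lborel) = G k (a + t)" .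
  qed (use s t in auto)
  then show ?thesis using \<open>d - 1 \<noteq> 0\<close> by (simp add: G_def)
qed

end

subsection \<open>The law of the margin\<close>

lemma prod_indicator_eq_if:
  fixes n :: nat
  shows "(\<Prod>i<n. indicator (A i) (z i) :: ennreal) = (if \<forall>i<n. z i \<in> A i then 1 else 0)"
proof (cases "\<forall>i<n. z i \<in> A i")
  case False
  then obtain i where "i < n" "z i \<notin> A i" by blast
  then have "(\<Prod>i<n. indicator (A i) (z i) :: ennreal) = 0" by (intro prod_zero bexI[of _ i]) auto
  with False show ?thesis by (simp only: if_False)
qed simp

context generator
begin

lemma psiE_nonneg: "0 \<le> z \<Longrightarrow> 0 \<le> psiE \<psi> z"
  by (cases z) (auto intro: psi_nonneg)

lemma psiE_Msum_eq_0:
  assumes "j < n" "u j = 0"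
  shows "psiE \<psi> (Msum \<psi> n u) = 0"
proof -
  have "phi \<psi> (u j) \<le> Msum \<psi> n u"
    unfolding Msum_def using sum_mono2[of "{..<n}" "{j}" "\<lambda>i. phi \<psi> (u i)"] assms(1) phi_nonneg by simp
  then have "phi \<psi> 0 \<le> Msum \<psi> n u" by (simp only: assms)
  then have "psiE \<psi> (Msum \<psi> n u) \<le> psiE \<psi> (phi \<psi> 0)" by (intro psiE_antimono phi_nonneg)
  with psiE_phi[of 0] psiE_nonneg[OF Msum_nonneg, of n u] show ?thesis by simp
qed

lemma Msum_const_1: "(\<And>i. i < n \<Longrightarrow> u i = 1) \<Longrightarrow> Msum \<psi> n u = 0"
  by (simp add: Msum_def)

lemma psiE_0 [simp]: "psiE \<psi> 0 = 1"
  by (simp add: zero_ereal_def)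

end

context d_monotone_generator
begin

text \<open>By \<open>psi_le_iff\<close> the box in the original coordinates is the orthant with
  corner \<open>phi \<psi> (u i)\<close>. If some corner coordinate is infinite, both sides are
  0.\<close>

lemma nn_integral_F_box:
  assumes g: "g = F (d - 1) \<or> g = F_cut" and s: "0 \<le> s" and u: "u \<in> cube (d - 1)"
  shows "(\<integral>\<^sup>+z. ennreal (g (s + (\<Sum>i<d - 1. z i))) * (\<Prod>i<d - 1. indicator {0<..} (z i)) * indicator {z. \<forall>i<d - 1. F 0 (z i) \<le> u i} z \<partial>PiM {..<d - 1} (\<lambda>_. lborel))
    = ennreal (psiE \<psi> (ereal s + Msum \<psi> (d - 1) u))"
proof -
  have le: "F 0 w \<le> u i \<longleftrightarrow> phi \<psi> (u i) \<le> ereal w" if "i < d - 1" "0 < w" for i w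
    using psi_le_iff[of w "u i"] cube_nth[OF u] that by simp
  show ?thesis
  proof (cases "\<exists>i<d - 1. phi \<psi> (u i) = \<infinity>")
    case True
    then obtain j where j: "j < d - 1" "phi \<psi> (u j) = \<infinity>" by blast
    have "(\<Prod>i<d - 1. indicator {0<..} (z i)) * indicator {z. \<forall>i<d - 1. F 0 (z i) \<le> u i} z = (0 :: ennreal)" for z :: "nat \<Rightarrow> real"
    proof (cases "0 < z j")
      case True
      then show ?thesis using le[of j "z j"] j by (auto simp del: F_0 simp: indicator_def)
    next
      case False
      then show ?thesis unfolding prod_indicator_eq_if using j by auto
    qed
    then have "(\<integral>\<^sup>+z. ennreal (g (s + (\<Sum>i<d - 1. z i))) * (\<Prod>i<d - 1. indicator {0<..} (z i)) * indicator {z. \<forall>i<d - 1. F 0 (z i) \<le> u i} z \<partial>PiM {..<d - 1} (\<lambda>_. lborel)) = 0"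
      by (simp only: mult.assoc mult_zero_right nn_integral_const mult_zero_left)
    moreover have "Msum \<psi> (d - 1) u = \<infinity>"
      unfolding Msum_def using sum_Pinfty[of "\<lambda>i. phi \<psi> (u i)" "{..<d - 1}"] j by auto
    ultimately show ?thesis by simp
  next
    case False
    define t where "t i = real_of_ereal (phi \<psi> (u i))" for i
    have t: "phi \<psi> (u i) = ereal (t i) \<and> 0 \<le> t i" if "i < d - 1" for i
      using False that phi_nonneg[of "u i"] by (cases "phi \<psi> (u i)") (auto simp: t_def)
    have "(\<Prod>i<d - 1. indicator {0<..} (z i)) * indicator {z. \<forall>i<d - 1. F 0 (z i) \<le> u i} z
      = (\<Prod>i<d - 1. indicator {w. 0 < w \<and> t i \<le> w} (z i) :: ennreal)" for z :: "nat \<Rightarrow> real"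
    proof (cases "\<forall>i<d - 1. 0 < z i")
      case True
      then have "(\<forall>i<d - 1. F 0 (z i) \<le> u i) \<longleftrightarrow> (\<forall>i<d - 1. t i \<le> z i)"
        using le t by (simp del: F_0)
      with True show ?thesis unfolding prod_indicator_eq_if by (auto simp: indicator_def simp del: F_0)
    next
      case False
      then show ?thesis unfolding prod_indicator_eq_if by auto
    qed
    then have "(\<integral>\<^sup>+z. ennreal (g (s + (\<Sum>i<d - 1. z i))) * (\<Prod>i<d - 1. indicator {0<..} (z i)) * indicator {z. \<forall>i<d - 1. F 0 (z i) \<le> u i} z \<partial>PiM {..<d - 1} (\<lambda>_. lborel))
      = ennreal (psiE \<psi> (ereal (s + (\<Sum>i<d - 1. t i))))"
      using nn_integral_F_orthant[OF g s, of t] t by (simp only: mult.assoc)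
    moreover have "Msum \<psi> (d - 1) u = ereal (\<Sum>i<d - 1. t i)"
      unfolding Msum_def using t by simp
    ultimately show ?thesis by simp
  qed
qed

text \<open>The candidate law of the \<open>phi\<close>-transformed margin, carried by the open
  positive orthant.\<close>

definition phi_law :: "(nat \<Rightarrow> real) measure" where
  "phi_law = density (PiM {..<d - 1} (\<lambda>_. lborel))
     (\<lambda>z. ennreal (F_cut (\<Sum>i<d - 1. z i)) * (\<Prod>i<d - 1. indicator {0<..} (z i)))"

text \<open>\<open>F 0\<close> is \<open>\<psi>\<close> continued by 1 to negative arguments, so
  every image point lies in the cube, even off the support of \<open>phi_law\<close>.\<close>

definition psi_map :: "(nat \<Rightarrow> real) \<Rightarrow> nat \<Rightarrow> real" where
  "psi_map z = (\<lambda>i\<in>{..<d - 1}. F 0 (z i))"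

lemma phi_law_density_measurable:
  "(\<lambda>z. ennreal (F_cut (\<Sum>i<d - 1. z i)) * (\<Prod>i<d - 1. indicator {0<..} (z i))) \<in> borel_measurable (PiM {..<d - 1} (\<lambda>_. lborel))"
  by measurable

lemma psi_map_measurable: "psi_map \<in> measurable (PiM {..<d - 1} (\<lambda>_. lborel)) (PiM {..<d - 1} (\<lambda>_. borel))"
  unfolding psi_map_def[abs_def] using F_measurable[of 0]
  by (intro measurable_restrict measurable_compose[OF measurable_component_singleton]) (auto simp del: F_0)

lemma psi_map_in_cube: "psi_map z \<in> cube (d - 1)"
proof -
  have "0 \<le> psiE \<psi> (ereal w) \<and> psiE \<psi> (ereal w) \<le> 1" for w
    using psi_nonneg[of w] psi_le_1[of w] by (cases "w < 0") auto
  then show ?thesis by (auto simp: psi_map_def cube_def)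
qed

lemma nn_integral_psi_map:
  assumes f: "f \<in> borel_measurable (PiM {..<d - 1} (\<lambda>_. borel))"
  shows "(\<integral>\<^sup>+x. f x \<partial>distr phi_law (PiM {..<d - 1} (\<lambda>_. borel)) psi_map)
    = (\<integral>\<^sup>+z. ennreal (F_cut (\<Sum>i<d - 1. z i)) * (\<Prod>i<d - 1. indicator {0<..} (z i)) * f (psi_map z) \<partial>PiM {..<d - 1} (\<lambda>_. lborel))"
proof -
  have "psi_map \<in> measurable phi_law (PiM {..<d - 1} (\<lambda>_. borel))"
    unfolding phi_law_def using psi_map_measurable by simp
  then have "(\<integral>\<^sup>+x. f x \<partial>distr phi_law (PiM {..<d - 1} (\<lambda>_. borel)) psi_map) = (\<integral>\<^sup>+z. f (psi_map z) \<partial>phi_law)"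
    by (rule nn_integral_distr) (use f in simp)
  also have "\<dots> = (\<integral>\<^sup>+z. ennreal (F_cut (\<Sum>i<d - 1. z i)) * (\<Prod>i<d - 1. indicator {0<..} (z i)) * f (psi_map z) \<partial>PiM {..<d - 1} (\<lambda>_. lborel))"
    unfolding phi_law_def
    by (rule nn_integral_density[OF phi_law_density_measurable]) (rule measurable_compose[OF psi_map_measurable f])
  finally show ?thesis .
qed

lemma lower_box_sets: "{x \<in> space (PiM {..<n} (\<lambda>_. borel)). \<forall>i<n. x i \<le> u i} \<in> sets (PiM {..<n} (\<lambda>_. borel :: real measure))" for n :: nat
  unfolding PiM_borel_eq_sigma_atMost by (rule sigma_sets.Basic) (simp add: space_PiM)

lemma emeasure_psi_map_law:
  assumes u: "u \<in> cube (d - 1)"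
  shows "emeasure (distr phi_law (PiM {..<d - 1} (\<lambda>_. borel)) psi_map) {x \<in> space (PiM {..<d - 1} (\<lambda>_. borel)). \<forall>i<d - 1. x i \<le> u i}
    = ennreal (psiE \<psi> (Msum \<psi> (d - 1) u))"
proof -
  let ?B = "{x \<in> space (PiM {..<d - 1} (\<lambda>_. borel)). \<forall>i<d - 1. x i \<le> u i}"
  have "emeasure (distr phi_law (PiM {..<d - 1} (\<lambda>_. borel)) psi_map) ?B
      = (\<integral>\<^sup>+x. indicator ?B x \<partial>distr phi_law (PiM {..<d - 1} (\<lambda>_. borel)) psi_map)"
    using lower_box_sets[of "d - 1" u] by simp
  also have "\<dots> = (\<integral>\<^sup>+z. ennreal (F_cut (0 + (\<Sum>i<d - 1. z i))) * (\<Prod>i<d - 1. indicator {0<..} (z i)) * indicator {z. \<forall>i<d - 1. F 0 (z i) \<le> u i} z \<partial>PiM {..<d - 1} (\<lambda>_. lborel))"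
    using lower_box_sets[of "d - 1" u] psi_map_in_cube
    by (subst nn_integral_psi_map)
       (auto intro!: nn_integral_cong simp: indicator_def psi_map_def space_PiM simp del: F_0)
  also have "\<dots> = ennreal (psiE \<psi> (Msum \<psi> (d - 1) u))"
    using nn_integral_F_box[of F_cut 0 u] u by simp
  finally show ?thesis .
qed

lemma prob_space_psi_map_law: "prob_space (distr phi_law (PiM {..<d - 1} (\<lambda>_. borel)) psi_map)"
proof
  let ?u = "\<lambda>i\<in>{..<d - 1}. 1 :: real"
  have u: "?u \<in> cube (d - 1)" by (auto simp: cube_def)
  have "emeasure (distr phi_law (PiM {..<d - 1} (\<lambda>_. borel)) psi_map) {x \<in> space (PiM {..<d - 1} (\<lambda>_. borel)). \<forall>i<d - 1. x i \<le> ?u i} = 1"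
    unfolding emeasure_psi_map_law[OF u] by (simp add: Msum_const_1)
  moreover have "emeasure (distr phi_law (PiM {..<d - 1} (\<lambda>_. borel)) psi_map) (space (PiM {..<d - 1} (\<lambda>_. borel)))
      = emeasure (distr phi_law (PiM {..<d - 1} (\<lambda>_. borel)) psi_map) {x \<in> space (PiM {..<d - 1} (\<lambda>_. borel)). \<forall>i<d - 1. x i \<le> ?u i}"
  proof -
    have T: "psi_map \<in> measurable phi_law (PiM {..<d - 1} (\<lambda>_. borel))"
      unfolding phi_law_def using psi_map_measurable by simp
    have "psi_map z i \<le> ?u i" if "i < d - 1" for z i
      using cube_nth[OF psi_map_in_cube] that by simp
    then have "psi_map -` space (PiM {..<d - 1} (\<lambda>_. borel)) \<inter> space phi_law
        = psi_map -` {x \<in> space (PiM {..<d - 1} (\<lambda>_. borel)). \<forall>i<d - 1. x i \<le> ?u i} \<inter> space phi_law"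
      by blast
    then show ?thesis
      using emeasure_distr[OF T sets.top] emeasure_distr[OF T lower_box_sets[of "d - 1" ?u]] by simp
  qed
  ultimately show "emeasure (distr phi_law (PiM {..<d - 1} (\<lambda>_. borel)) psi_map) (space (distr phi_law (PiM {..<d - 1} (\<lambda>_. borel)) psi_map)) = 1"
    by simp
qed

end

subsection \<open>Disintegration\<close>

locale archimedean_copula_law = d_monotone_generator +
  fixes \<mu> :: "(nat \<Rightarrow> real) measure"
  assumes sets_mu: "sets \<mu> = sets (PiM {..<d} (\<lambda>_. borel))"
    and prob_mu: "prob_space \<mu>"
    and cdf: "\<forall>u \<in> cube d. measure \<mu> {v \<in> space \<mu>. \<forall>i<d. v i \<le> u i} = psiE \<psi> (\<Sum>i<d. phi \<psi> (u i))"
begin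

abbreviation marginal :: "(nat \<Rightarrow> real) measure" where
  "marginal \<equiv> distr \<mu> (PiM {..<d - 1} (\<lambda>_. borel)) (\<lambda>v. restrict v {..<d - 1})"

lemma lessThan_d: "{..<d} = insert (d - 1) {..<d - 1}"
  using d3 by auto

lemma all_less_d: "(\<forall>i<d. P i) \<longleftrightarrow> P (d - 1) \<and> (\<forall>i<d - 1. P i)"
  using lessThan_d by (metis insert_iff lessThan_iff)

lemma Msum_d: "Msum \<psi> d u = Msum \<psi> (d - 1) u + phi \<psi> (u (d - 1))"
  unfolding Msum_def lessThan_d by (subst sum.insert) (auto simp: add.commute)

lemma emeasure_mu_box:
  assumes "u \<in> cube d"
  shows "emeasure \<mu> {v \<in> space \<mu>. \<forall>i<d. v i \<le> u i} = ennreal (psiE \<psi> (Msum \<psi> d u))"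
proof -
  interpret prob_space \<mu> by (rule prob_mu)
  show ?thesis using cdf assms by (simp add: emeasure_eq_measure Msum_def)
qed

lemma emeasure_mu_one: "emeasure \<mu> {v \<in> space \<mu>. \<forall>i<d. v i \<le> 1} = 1"
  using emeasure_mu_box[of "\<lambda>i\<in>{..<d}. 1"] by (simp add: Msum_const_1 cube_def)

lemma emeasure_mu_zero:
  assumes "j < d"
  shows "emeasure \<mu> {v \<in> space \<mu>. \<forall>i<d. v i \<le> (if i = j then 0 else 1)} = 0"
proof -
  let ?u = "\<lambda>i\<in>{..<d}. if i = j then 0 else 1 :: real"
  have "?u \<in> cube d" by (auto simp: cube_def)
  from emeasure_mu_box[OF this] psiE_Msum_eq_0[of j d ?u] assms show ?thesis by simp
qed

lemma AE_mu: "AE v in \<mu>. \<forall>i<d. 0 < v i \<and> v i \<le> 1"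
  by (rule AE_unit_box[OF prob_mu sets_mu emeasure_mu_one emeasure_mu_zero])

lemma restrict_measurable_mu: "(\<lambda>v. restrict v {..<d - 1}) \<in> measurable \<mu> (PiM {..<d - 1} (\<lambda>_. borel))"
  unfolding measurable_cong_sets[OF sets_mu refl] by (rule measurable_restrict_subset) auto

lemma prob_space_marginal: "prob_space marginal"
  using prob_space.prob_space_distr[OF prob_mu restrict_measurable_mu] .

lemma space_mu: "space \<mu> = PiE {..<d} (\<lambda>_. UNIV)"
  using sets_eq_imp_space_eq[OF sets_mu] by (simp add: space_PiM)

lemma mu_box_sets: "{v \<in> space \<mu>. \<forall>i<d. v i \<le> u i} \<in> sets \<mu>"
  using lower_box_sets[of d u] by (simp add: sets_mu space_mu space_PiM)

lemma emeasure_marginal_box: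
  assumes u: "u \<in> cube (d - 1)"
  shows "emeasure marginal {x \<in> space marginal. \<forall>i<d - 1. x i \<le> u i} = ennreal (psiE \<psi> (Msum \<psi> (d - 1) u))"
proof -
  \<comment> \<open>Bounding the last coordinate by 1 excludes only a null set, and
    \<open>phi \<psi> 1 = 0\<close> removes it from the sum.\<close>
  let ?w = "u(d - 1 := 1)"
  let ?B = "{x \<in> space (PiM {..<d - 1} (\<lambda>_. borel)). \<forall>i<d - 1. x i \<le> u i}"
  have w: "?w \<in> cube d"
    using u unfolding cube_def lessThan_d by (intro PiE_fun_upd) auto
  have "emeasure marginal {x \<in> space marginal. \<forall>i<d - 1. x i \<le> u i}
      = emeasure \<mu> ((\<lambda>v. restrict v {..<d - 1}) -` ?B \<inter> space \<mu>)"
    using emeasure_distr[OF restrict_measurable_mu lower_box_sets[of "d - 1" u]] by simp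
  also have "\<dots> = emeasure \<mu> {v \<in> space \<mu>. \<forall>i<d. v i \<le> ?w i}"
  proof (rule emeasure_eq_AE)
    show "AE v in \<mu>. (v \<in> (\<lambda>v. restrict v {..<d - 1}) -` ?B \<inter> space \<mu>) = (v \<in> {v \<in> space \<mu>. \<forall>i<d. v i \<le> ?w i})"
      using AE_mu
    proof eventually_elim
      case (elim v)
      then have "v (d - 1) \<le> 1" using d3 by simp
      moreover have "restrict v {..<d - 1} \<in> space (PiM {..<d - 1} (\<lambda>_. borel))" by (simp add: space_PiM)
      moreover have "(\<forall>i<d - 1. restrict v {..<d - 1} i \<le> u i) \<longleftrightarrow> (\<forall>i<d - 1. v i \<le> ?w i)" by simp
      moreover have "?w (d - 1) = 1" by simp
      ultimately show ?case unfolding all_less_d mem_Collect_eq vimage_eq Int_iff by metis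
    qed
  qed (rule measurable_sets[OF restrict_measurable_mu lower_box_sets] mu_box_sets)+
  also have "\<dots> = ennreal (psiE \<psi> (Msum \<psi> d ?w))" by (rule emeasure_mu_box[OF w])
  also have "Msum \<psi> d ?w = Msum \<psi> (d - 1) u"
    unfolding Msum_d by (simp add: Msum_def)
  finally show ?thesis .
qed

lemma marginal_eq: "marginal = distr phi_law (PiM {..<d - 1} (\<lambda>_. borel)) psi_map"
proof (rule measure_eqI_cdf_unit_box[OF prob_space_marginal _ prob_space_psi_map_law])
  show "emeasure marginal {v \<in> space marginal. \<forall>i<d - 1. v i \<le> u i}
      = emeasure (distr phi_law (PiM {..<d - 1} (\<lambda>_. borel)) psi_map)
          {v \<in> space (distr phi_law (PiM {..<d - 1} (\<lambda>_. borel)) psi_map). \<forall>i<d - 1. v i \<le> u i}"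
    if "u \<in> cube (d - 1)" for u
    unfolding emeasure_marginal_box[OF that] using emeasure_psi_map_law[OF that] by simp
  show "emeasure marginal {v \<in> space marginal. \<forall>i<d - 1. v i \<le> 1} = 1"
    using emeasure_marginal_box[of "\<lambda>i\<in>{..<d - 1}. 1"] by (simp add: Msum_const_1 cube_def)
  show "emeasure marginal {v \<in> space marginal. \<forall>i<d - 1. v i \<le> (if i = j then 0 else 1)} = 0" if "j < d - 1" for j
  proof -
    let ?u = "\<lambda>i\<in>{..<d - 1}. if i = j then 0 else 1 :: real"
    have "?u \<in> cube (d - 1)" by (auto simp: cube_def)
    from emeasure_marginal_box[OF this] psiE_Msum_eq_0[of j "d - 1" ?u] that show ?thesis by simp
  qed
qed simp_all

lemma cube_sets: "cube (d - 1) \<in> sets (PiM {..<d - 1} (\<lambda>_. borel))"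
  unfolding cube_def by (rule sets_PiM_I_finite) auto

text \<open>Below \<open>phi \<psi> 0\<close> every \<open>z i\<close> is recovered by
  \<open>phi\<close> from its image, so the density is the kernel's denominator and cancels; from
  there on both sides vanish. The case \<open>phi \<psi> y = 0\<close> is kept apart because
  \<open>F_cut\<close> and \<open>F_ext\<close> may differ at \<open>phi \<psi> 0\<close>
  itself.\<close>

lemma KC_times_density:
  assumes z: "\<And>i. i < d - 1 \<Longrightarrow> 0 < z i" and y: "0 \<le> y" "y \<le> 1"
  shows "F_cut (\<Sum>i<d - 1. z i) * KC d \<psi> (psi_map z) y
    = (if phi \<psi> y = 0 then F_cut (\<Sum>i<d - 1. z i) else F_ext (ereal (\<Sum>i<d - 1. z i) + phi \<psi> y))"
proof -
  define S where "S = (\<Sum>i<d - 1. z i)"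
  have "0 \<in> {..<d - 1}" using d3 by simp
  then have "{..<d - 1} \<noteq> {}" by blast
  then have S: "0 < S" unfolding S_def using z by (intro sum_pos) auto
  show ?thesis
  proof (cases "ereal S < phi \<psi> 0")
    case True
    have "phi \<psi> (F 0 (z i)) = ereal (z i)" if i: "i < d - 1" for i
    proof -
      have "z i \<le> S" unfolding S_def by (rule member_le_sum) (use i z in \<open>auto intro: less_imp_le\<close>)
      then have "ereal (z i) \<le> phi \<psi> 0" using True by (metis ereal_less_eq(3) less_imp_le order_trans)
      with phi_psi[of "z i"] z[OF i] show ?thesis by simp
    qed
    then have "Msum \<psi> (d - 1) (psi_map z) = ereal S"
      by (simp add: Msum_def psi_map_def S_def del: F_0)
    with KC_eq[OF psi_map_in_cube y, of z] S True F_top_pos[OF S True] show ?thesis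
      unfolding S_def[symmetric] by (auto simp: F_cut_def zero_ereal_def)
  next
    case False
    have "F_ext (ereal S + phi \<psi> y) = 0" if "phi \<psi> y \<noteq> 0"
    proof (cases "phi \<psi> y")
      case (real r)
      with that phi_nonneg[of y] have "0 < r" by (auto simp: zero_ereal_def)
      with False have "phi \<psi> 0 < ereal (S + r)" by (cases "phi \<psi> 0") auto
      then show ?thesis using F_ext_eq_0[of "ereal (S + r)"] real by simp
    qed (use phi_nonneg[of y] in auto)
    with False show ?thesis unfolding S_def[symmetric] by (simp add: F_cut_def)
  qed
qed

text \<open>After transport to the \<open>z\<close> coordinates the integrand is a shifted top
  member. The shift \<open>phi \<psi> y\<close> is 0 for \<open>y = 1\<close>
  (\<open>F_cut\<close>), positive and finite (\<open>F (d - 1)\<close>), or infinite, when both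
  sides are 0.\<close>

lemma nn_integral_KC_box:
  assumes u: "u \<in> cube (d - 1)" and y: "y \<in> {0..1}"
  shows "(\<integral>\<^sup>+x. ennreal (KC d \<psi> x y) * indicator (cube (d - 1)) x * indicator {x. \<forall>i<d - 1. x i \<le> u i} x \<partial>marginal)
    = ennreal (psiE \<psi> (Msum \<psi> (d - 1) u + phi \<psi> y))"
proof -
  let ?M = "PiM {..<d - 1} (\<lambda>_. borel) :: (nat \<Rightarrow> real) measure"
  let ?f = "\<lambda>x. ennreal (KC d \<psi> x y) * indicator (cube (d - 1)) x * indicator {x. \<forall>i<d - 1. x i \<le> u i} x"
  let ?P = "\<lambda>z. (\<Prod>i<d - 1. indicator {0<..} (z i)) :: ennreal"
  have "(\<lambda>x. ennreal (KC d \<psi> x y) * indicator (cube (d - 1)) x) \<in> borel_measurable ?M"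
    using KC_measurable[OF y] cube_sets
    by (subst borel_measurable_restrict_space_iff_ennreal[symmetric]) auto
  then have "(\<lambda>x. ennreal (KC d \<psi> x y) * indicator (cube (d - 1)) x * indicator {x \<in> space ?M. \<forall>i<d - 1. x i \<le> u i} x) \<in> borel_measurable ?M"
    using lower_box_sets[of "d - 1" u] by (rule borel_measurable_times_ennreal[OF _ borel_measurable_indicator])
  then have f: "?f \<in> borel_measurable ?M"
    by (rule measurable_cong[THEN iffD1, rotated]) (simp add: indicator_def)
  have "(\<integral>\<^sup>+x. ?f x \<partial>marginal)
      = (\<integral>\<^sup>+z. ennreal (F_cut (\<Sum>i<d - 1. z i)) * ?P z * ?f (psi_map z) \<partial>PiM {..<d - 1} (\<lambda>_. lborel))"
    unfolding marginal_eq by (rule nn_integral_psi_map[OF f])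
  also have "\<dots> = (\<integral>\<^sup>+z. ennreal (if phi \<psi> y = 0 then F_cut (\<Sum>i<d - 1. z i) else F_ext (ereal (\<Sum>i<d - 1. z i) + phi \<psi> y))
      * ?P z * indicator {z. \<forall>i<d - 1. F 0 (z i) \<le> u i} z \<partial>PiM {..<d - 1} (\<lambda>_. lborel))"
  proof (rule nn_integral_cong)
    fix z :: "nat \<Rightarrow> real"
    have ind: "indicator {x. \<forall>i<d - 1. x i \<le> u i} (psi_map z) = (indicator {z. \<forall>i<d - 1. F 0 (z i) \<le> u i} z :: ennreal)"
      by (simp add: indicator_def psi_map_def del: F_0)
    show "ennreal (F_cut (\<Sum>i<d - 1. z i)) * ?P z * ?f (psi_map z)
      = ennreal (if phi \<psi> y = 0 then F_cut (\<Sum>i<d - 1. z i) else F_ext (ereal (\<Sum>i<d - 1. z i) + phi \<psi> y))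
      * ?P z * indicator {z. \<forall>i<d - 1. F 0 (z i) \<le> u i} z"
    proof (cases "\<forall>i<d - 1. 0 < z i")
      case True
      then have "?P z = 1" unfolding prod_indicator_eq_if by simp
      moreover have "ennreal (F_cut (\<Sum>i<d - 1. z i)) * ennreal (KC d \<psi> (psi_map z) y)
        = ennreal (if phi \<psi> y = 0 then F_cut (\<Sum>i<d - 1. z i) else F_ext (ereal (\<Sum>i<d - 1. z i) + phi \<psi> y))"
        using KC_times_density[of z y] True y
        by (subst ennreal_mult'[symmetric]) (auto intro: F_cut_nonneg)
      ultimately show ?thesis using psi_map_in_cube[of z] unfolding ind
        by (simp add: mult.assoc[symmetric] del: F_0)
    next
      case False
      then have "?P z = 0" unfolding prod_indicator_eq_if by auto
      then show ?thesis by (simp only: mult_zero_right mult_zero_left)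
    qed
  qed
  also have "\<dots> = ennreal (psiE \<psi> (Msum \<psi> (d - 1) u + phi \<psi> y))"
  proof (cases "phi \<psi> y")
    case (real s)
    with phi_nonneg[of y] have s: "0 \<le> s" by simp
    show ?thesis
    proof (cases "s = 0")
      case True
      with real have p0: "phi \<psi> y = 0" by simp
      show ?thesis unfolding p0 using nn_integral_F_box[of F_cut 0 u] u by (simp add: zero_ereal_def[symmetric] del: F_0)
    next
      case False
      have "(if phi \<psi> y = 0 then F_cut w else F_ext (ereal w + phi \<psi> y)) = F (d - 1) (s + w)" for w
        using False real by (simp add: zero_ereal_def add.commute)
      then show ?thesis using nn_integral_F_box[of "F (d - 1)" s u] u s real
        by (simp add: add.commute del: F_0)
    qed
  next
    case PInf
    then show ?thesis using Msum_nonneg[of "d - 1" u] by (simp del: F_0)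
  qed (use phi_nonneg[of y] in auto)
  finally show ?thesis .
qed

text \<open>Draw \<open>x\<close> from the margin, then the last coordinate from the kernel at
  \<open>x\<close>. The margin is restricted to the cube because the kernel is shown to be a
  probability measure only there.\<close>

definition kernel_law :: "(nat \<Rightarrow> real) measure" where
  "kernel_law = restrict_space marginal (cube (d - 1)) \<bind>
     (\<lambda>x. distr (KC_measure d \<psi> x) (PiM {..<d} (\<lambda>_. borel)) (\<lambda>y. x(d - 1 := y)))"

lemma sets_restrict_marginal: "sets (restrict_space marginal (cube (d - 1))) = sets cube_space"
  by (intro sets_restrict_space_cong) simp

lemma fun_upd_measurable:
  "(\<lambda>(x, y). x(d - 1 := y)) \<in> measurable (cube_space \<Otimes>\<^sub>M borel) (PiM {..<d} (\<lambda>_. borel :: real measure))"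
proof -
  have "(\<lambda>(x, y). x(d - 1 := y)) \<in> measurable (PiM {..<d - 1} (\<lambda>_. borel) \<Otimes>\<^sub>M borel) (PiM {..<d} (\<lambda>_. borel :: real measure))"
    unfolding lessThan_d by (rule measurable_add_dim)
  moreover have "(\<lambda>p. (fst p, snd p)) \<in> measurable (cube_space \<Otimes>\<^sub>M borel) (PiM {..<d - 1} (\<lambda>_. borel) \<Otimes>\<^sub>M (borel :: real measure))"
    by (intro measurable_Pair measurable_snd measurable_compose[OF measurable_fst] measurable_restrict_space1 measurable_ident_sets) simp
  ultimately show ?thesis by (auto dest: measurable_compose[rotated])
qed

lemma kernel_measurable:
  "(\<lambda>x. distr (KC_measure d \<psi> x) (PiM {..<d} (\<lambda>_. borel)) (\<lambda>y. x(d - 1 := y)))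
    \<in> measurable (restrict_space marginal (cube (d - 1))) (prob_algebra (PiM {..<d} (\<lambda>_. borel)))"
  unfolding measurable_cong_sets[OF sets_restrict_marginal refl]
  by (rule measurable_distr_prob_space2[OF KC_measure_measurable fun_upd_measurable])

lemma space_restrict_marginal [simp]: "space (restrict_space marginal (cube (d - 1))) = cube (d - 1)"
  using sets_eq_imp_space_eq[OF sets_restrict_marginal] by simp

lemma emeasure_kernel_law:
  assumes G: "G \<in> sets (PiM {..<d} (\<lambda>_. borel))"
  shows "emeasure kernel_law G = (\<integral>\<^sup>+ x \<in> cube (d - 1). emeasure (KC_measure d \<psi> x) {y. x(d - 1 := y) \<in> G} \<partial>marginal)"
proof -
  have "emeasure kernel_law G = (\<integral>\<^sup>+x. emeasure (distr (KC_measure d \<psi> x) (PiM {..<d} (\<lambda>_. borel)) (\<lambda>y. x(d - 1 := y))) G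
      \<partial>restrict_space marginal (cube (d - 1)))"
    unfolding kernel_law_def
  proof (rule emeasure_bind[OF _ measurable_prob_algebraD[OF kernel_measurable] G])
    show "space (restrict_space marginal (cube (d - 1))) \<noteq> {}" using psi_map_in_cube by auto
  qed
  also have "\<dots> = (\<integral>\<^sup>+x. emeasure (KC_measure d \<psi> x) {y. x(d - 1 := y) \<in> G} \<partial>restrict_space marginal (cube (d - 1)))"
  proof (rule nn_integral_cong)
    fix x assume "x \<in> space (restrict_space marginal (cube (d - 1)))"
    then have "x \<in> space cube_space" by simp
    with fun_upd_measurable have "(\<lambda>y. x(d - 1 := y)) \<in> measurable borel (PiM {..<d} (\<lambda>_. borel))"
      by (auto dest: measurable_Pair2)
    then have "(\<lambda>y. x(d - 1 := y)) \<in> measurable (KC_measure d \<psi> x) (PiM {..<d} (\<lambda>_. borel))"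
      by (simp add: measurable_cong_sets[OF sets_KC_measure refl])
    from emeasure_distr[OF this G]
    show "emeasure (distr (KC_measure d \<psi> x) (PiM {..<d} (\<lambda>_. borel)) (\<lambda>y. x(d - 1 := y))) G = emeasure (KC_measure d \<psi> x) {y. x(d - 1 := y) \<in> G}"
      by (simp add: vimage_def)
  qed
  also have "\<dots> = (\<integral>\<^sup>+ x \<in> cube (d - 1). emeasure (KC_measure d \<psi> x) {y. x(d - 1 := y) \<in> G} \<partial>marginal)"
    using cube_sets by (intro nn_integral_restrict_space) simp
  finally show ?thesis .
qed

lemma sets_kernel_law: "sets kernel_law = sets (PiM {..<d} (\<lambda>_. borel))"
  unfolding kernel_law_def
  by (rule sets_bind) (use psi_map_in_cube in auto)

lemma prob_space_kernel_law: "prob_space kernel_law"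
proof -
  have sp: "{x \<in> space (PiM {..<d - 1} (\<lambda>_. borel)). x \<in> cube (d - 1)} = cube (d - 1)"
    by (auto simp: space_PiM cube_def)
  \<comment> \<open>The representation by \<open>psi_map\<close> gives this for free, so restricting
    to the cube loses no mass.\<close>
  have "AE x in marginal. x \<in> cube (d - 1)"
    unfolding marginal_eq using psi_map_in_cube cube_sets psi_map_measurable
    by (subst AE_distr_iff) (auto simp: phi_law_def)
  then have "prob_space (restrict_space marginal (cube (d - 1)))"
    using prob_space.AE_iff_emeasure_eq_1[OF prob_space_marginal, of "\<lambda>x. x \<in> cube (d - 1)"] cube_sets sp
    by (intro prob_space_restrict_space) simp_all
  then have "restrict_space marginal (cube (d - 1)) \<in> space (prob_algebra (restrict_space marginal (cube (d - 1))))"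
    by (simp add: space_prob_algebra)
  then show ?thesis unfolding kernel_law_def by (rule prob_space_bind'[OF _ kernel_measurable])
qed

lemma kernel_law_eq: "kernel_law = \<mu>"
proof (rule measure_eqI_cdf_unit_box[OF prob_mu sets_mu prob_space_kernel_law sets_kernel_law _ emeasure_mu_one emeasure_mu_zero, symmetric])
  fix u assume u: "u \<in> cube d"
  define w where "w = restrict u {..<d - 1}"
  have w: "w \<in> cube (d - 1)" using u d3 by (auto simp: w_def cube_def PiE_iff)
  have y: "u (d - 1) \<in> {0..1}" using cube_nth[OF u, of "d - 1"] d3 by simp
  have sp: "space kernel_law = PiE {..<d} (\<lambda>_. UNIV)"
    using sets_eq_imp_space_eq[OF sets_kernel_law] by (simp add: space_PiM)
  let ?G = "{v \<in> PiE {..<d} (\<lambda>_. UNIV). \<forall>i<d. v i \<le> u i}"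
  have G: "?G \<in> sets (PiM {..<d} (\<lambda>_. borel))" using lower_box_sets[of d u] by (simp add: space_PiM)
  have "emeasure kernel_law ?G = (\<integral>\<^sup>+ x \<in> cube (d - 1). emeasure (KC_measure d \<psi> x) {y. x(d - 1 := y) \<in> ?G} \<partial>marginal)"
    by (rule emeasure_kernel_law[OF G])
  also have "\<dots> = (\<integral>\<^sup>+x. ennreal (KC d \<psi> x (u (d - 1))) * indicator (cube (d - 1)) x * indicator {x. \<forall>i<d - 1. x i \<le> w i} x \<partial>marginal)"
  proof (rule nn_integral_cong)
    fix x
    have "emeasure (KC_measure d \<psi> x) {y. x(d - 1 := y) \<in> ?G} = ennreal (KC d \<psi> x (u (d - 1))) * indicator {x. \<forall>i<d - 1. x i \<le> w i} x"
      if x: "x \<in> cube (d - 1)"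
    proof -
      have "x(d - 1 := y) \<in> PiE {..<d} (\<lambda>_. UNIV)" for y
        using x unfolding cube_def lessThan_d by (intro PiE_fun_upd) auto
      \<comment> \<open>Sections of a lower box are a half-line or empty, so only the distribution
        function of the kernel enters.\<close>
      then have "{y. x(d - 1 := y) \<in> ?G} = (if \<forall>i<d - 1. x i \<le> w i then {..u (d - 1)} else {})"
        unfolding all_less_d by (auto simp: w_def)
      then show ?thesis using emeasure_KC_measure_atMost[OF x, of "u (d - 1)"] y by (simp add: indicator_def)
    qed
    then show "emeasure (KC_measure d \<psi> x) {y. x(d - 1 := y) \<in> ?G} * indicator (cube (d - 1)) x
      = ennreal (KC d \<psi> x (u (d - 1))) * indicator (cube (d - 1)) x * indicator {x. \<forall>i<d - 1. x i \<le> w i} x"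
      by (cases "x \<in> cube (d - 1)") simp_all
  qed
  also have "\<dots> = ennreal (psiE \<psi> (Msum \<psi> (d - 1) w + phi \<psi> (u (d - 1))))"
    by (rule nn_integral_KC_box[OF w y])
  also have "Msum \<psi> (d - 1) w + phi \<psi> (u (d - 1)) = Msum \<psi> d u"
    unfolding Msum_d by (simp add: Msum_def w_def)
  finally show "emeasure \<mu> {v \<in> space \<mu>. \<forall>i<d. v i \<le> u i} = emeasure kernel_law {v \<in> space kernel_law. \<forall>i<d. v i \<le> u i}"
    unfolding sp using emeasure_mu_box[OF u] by simp
qed

end

theorem theorem3p1:
  fixes d :: nat and \<psi> :: "real \<Rightarrow> real" and \<mu> :: "(nat \<Rightarrow> real) measure"
  assumes d3: "d \<ge> 3"
    and gen: "archimedean_generator \<psi>"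
    and dmon: "d_monotone d \<psi>"
    and norm: "\<psi> 1 = 1 / 2"
    and sets_mu: "sets \<mu> = sets (PiM {..<d} (\<lambda>_. borel))"
    and probmu: "prob_space \<mu>"
    and cdf: "\<forall>u \<in> cube d.
               measure \<mu> {v \<in> space \<mu>. \<forall>i<d. v i \<le> u i} = psiE \<psi> (\<Sum>i<d. phi \<psi> (u i))"
  shows "(\<forall>x \<in> cube (d - 1).
            mono_on {0..1} (KC d \<psi> x) \<and>
            (\<forall>y \<in> {0..<1}. continuous (at_right y) (KC d \<psi> x)) \<and>
            (\<forall>y \<in> {0..1}. 0 \<le> KC d \<psi> x y) \<and>
            KC d \<psi> x 1 = 1)
       \<and> (\<forall>x \<in> cube (d - 1). prob_space (KC_measure d \<psi> x) \<and>
            emeasure (KC_measure d \<psi> x) {0..1} = 1 \<and>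
            (\<forall>y \<in> {0..1}. emeasure (KC_measure d \<psi> x) {..y} = ennreal (KC d \<psi> x y)))
       \<and> (\<forall>E \<in> sets borel. (\<lambda>x. emeasure (KC_measure d \<psi> x) E)
              \<in> borel_measurable (restrict_space (PiM {..<d-1} (\<lambda>_. borel)) (cube (d - 1))))
       \<and> (\<forall>G \<in> sets (PiM {..<d} (\<lambda>_. borel)).
            emeasure \<mu> G =
              (\<integral>\<^sup>+ x \<in> cube (d - 1). emeasure (KC_measure d \<psi> x) {y. x(d - 1 := y) \<in> G}
                 \<partial>(distr \<mu> (PiM {..<d-1} (\<lambda>_. borel)) (\<lambda>v. restrict v {..<d-1}))))"
proof -
  interpret archimedean_copula_law \<psi> d \<mu>
    by (intro archimedean_copula_law.intro d_monotone_generator.intro generator.intro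
        d_monotone_generator_axioms.intro archimedean_copula_law_axioms.intro assms)
  have cont: "continuous (at_right y) (KC d \<psi> x)" if "x \<in> cube (d - 1)" "y \<in> {0..<1}" for x y
    using KC_right_tendsto[OF that] by (simp add: continuous_within)
  have atMost: "emeasure (KC_measure d \<psi> x) {..y} = ennreal (KC d \<psi> x y)" if "x \<in> cube (d - 1)" "y \<in> {0..1}" for x y
    using emeasure_KC_measure_atMost[OF that(1), of y] that(2) by simp
  have meas: "(\<lambda>x. emeasure (KC_measure d \<psi> x) E) \<in> borel_measurable cube_space" if "E \<in> sets borel" for E
    by (rule measurable_emeasure_kernel[OF measurable_prob_algebraD[OF KC_measure_measurable] that])
  have disint: "emeasure \<mu> G = (\<integral>\<^sup>+ x \<in> cube (d - 1). emeasure (KC_measure d \<psi> x) {y. x(d - 1 := y) \<in> G} \<partial>marginal)"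
    if "G \<in> sets (PiM {..<d} (\<lambda>_. borel))" for G
    using emeasure_kernel_law[OF that] unfolding kernel_law_eq .
  show ?thesis
    by (intro conjI ballI KC_mono_on cont KC_nonneg KC_1 prob_space_KC_measure
        emeasure_KC_measure_unit atMost meas disint)
qed

end
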